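(* Let $\alpha\in(0,1)$ be a constant, $r$ a positive integer and $\varepsilon\in\big(0,\alpha(1-\alpha)/4\big)$. Given a known quantum state $\sigma$ of rank $r$ and copies of an unknown quantum state $\rho$ promised to have rank at most $r$, any quantum algorithm estimating $\mathrm{D}^{\mathrm{T}}_\alpha(\rho\|\sigma)$ within additive error $\varepsilon$ (with success probability at least $2/3$) requires $\Omega(r/\varepsilon+1/\varepsilon^2)$ samples of $\rho$.
   Context: $\mathrm{D}^{\mathrm{T}}_\alpha(\rho\|\sigma)=\frac{1}{1-\alpha}\big(1-\operatorname{tr}(\rho^\alpha\sigma^{1-\alpha})\big)$ for density operators $\rho,\sigma$. *)

theory Defs
  imports "Jordan_Normal_Form.Schur_Decomposition" "Jordan_Normal_Form.DL_Rank"
begin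

definition mtrace :: "complex mat \<Rightarrow> complex" where
  "mtrace A = (\<Sum>i<dim_row A. A $$ (i, i))"

definition hermitian_mat :: "nat \<Rightarrow> complex mat \<Rightarrow> bool" where
  "hermitian_mat d A \<longleftrightarrow> A \<in> carrier_mat d d \<and> mat_adjoint A = A"

definition psd_mat :: "nat \<Rightarrow> complex mat \<Rightarrow> bool" where
  "psd_mat d A \<longleftrightarrow> hermitian_mat d A \<and>
     (\<forall>v \<in> carrier_vec d. 0 \<le> Re ((A *\<^sub>v v) \<bullet>c v))"

definition density_op :: "nat \<Rightarrow> complex mat \<Rightarrow> bool" where
  "density_op d \<rho> \<longleftrightarrow> psd_mat d \<rho> \<and> mtrace \<rho> = 1"

definition unitary_mat :: "nat \<Rightarrow> complex mat \<Rightarrow> bool" where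
  "unitary_mat d U \<longleftrightarrow> U \<in> carrier_mat d d \<and> U * mat_adjoint U = 1\<^sub>m d"

definition mrank :: "complex mat \<Rightarrow> nat" where
  "mrank A = vec_space.rank (dim_row A) A"

text \<open>Real power of a positive semidefinite matrix via its spectral decomposition
  A = U diag(lambda) U^*, A^a = U diag(lambda^a) U^*  (with 0^a = 0, the
  standard convention on the kernel, only used here for a > 0).\<close>
definition mat_powr :: "complex mat \<Rightarrow> real \<Rightarrow> complex mat" where
  "mat_powr A a = (SOME B. \<exists>U lam. unitary_mat (dim_row A) U \<and> (\<forall>i. 0 \<le> lam i) \<and>
      A = U * mat_diag (dim_row A) (\<lambda>i. complex_of_real (lam i)) * mat_adjoint U \<and>
      B = U * mat_diag (dim_row A) (\<lambda>i. complex_of_real (lam i powr a)) * mat_adjoint U)"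

definition tsallis_rel_ent :: "real \<Rightarrow> complex mat \<Rightarrow> complex mat \<Rightarrow> real" where
  "tsallis_rel_ent \<alpha> \<rho> \<sigma> =
     (1 - Re (mtrace (mat_powr \<rho> \<alpha> * mat_powr \<sigma> (1 - \<alpha>)))) / (1 - \<alpha>)"

definition kron :: "complex mat \<Rightarrow> complex mat \<Rightarrow> complex mat" where
  "kron A B = mat (dim_row A * dim_row B) (dim_col A * dim_col B)
     (\<lambda>(i, j). A $$ (i div dim_row B, j div dim_col B) * B $$ (i mod dim_row B, j mod dim_col B))"

fun tensor_pow :: "complex mat \<Rightarrow> nat \<Rightarrow> complex mat" where
  "tensor_pow A 0 = 1\<^sub>m 1"
| "tensor_pow A (Suc n) = kron A (tensor_pow A n)"

definition povm :: "nat \<Rightarrow> nat \<Rightarrow> (nat \<Rightarrow> complex mat) \<Rightarrow> bool" where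
  "povm D K M \<longleftrightarrow> (\<forall>k<K. psd_mat D (M k)) \<and>
     (\<forall>i<D. \<forall>j<D. (\<Sum>k<K. M k $$ (i, j)) = (if i = j then 1 else 0))"

text \<open>Probability that a quantum algorithm using n copies of rho, modelled as the
  most general joint measurement (POVM M with K outcomes) on rho^{(x)n} followed by
  outputting the estimate x k on outcome k, outputs a value within eps of target t.\<close>
definition success_prob ::
  "nat \<Rightarrow> nat \<Rightarrow> (nat \<Rightarrow> complex mat) \<Rightarrow> (nat \<Rightarrow> real) \<Rightarrow> complex mat \<Rightarrow> real \<Rightarrow> real \<Rightarrow> real" where
  "success_prob n K M x \<rho> t \<epsilon> =
     (\<Sum>k\<in>{k. k < K \<and> \<bar>x k - t\<bar> \<le> \<epsilon>}. Re (mtrace (M k * tensor_pow \<rho> n)))"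

end

theory Submission
  imports Defs "HOL-Combinatorics.Permutations"
begin

text \<open>
  Either summand of the rate may dominate, and the state \<open>\<sigma>\<close> is chosen accordingly.

  If \<open>r \<le> 1 / \<epsilon>\<close>, then \<open>\<sigma>\<close> gives weight at least \<open>1 / 2\<close> to one basis vector and misses one
  dimension. Rotating a pure state between these two directions moves the divergence linearly in
  the squared amplitude, whereas pure states at angle of order \<open>\<epsilon>\<close> need order \<open>1 / \<epsilon>\<^sup>2\<close> copies to
  be told apart.

  If \<open>r > 1 / \<epsilon>\<close>, then \<open>\<sigma>\<close> is maximally mixed in dimension \<open>r\<close>. It is at divergence \<open>0\<close> from itself
  and more than \<open>2 \<epsilon>\<close> from the states \<open>(1 + \<delta> A) / r\<close>, where \<open>A\<close> is the adjacency matrix of a matching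
  \<open>i \<leftrightarrow> m + \<pi> i\<close> and \<open>\<delta>\<^sup>2\<close> is of order \<open>\<epsilon>\<close>. For a uniformly random permutation \<open>\<pi>\<close> the chi-square
  distance of the averaged \<open>n\<close>-fold tensor power to the maximally mixed state is
  \<open>E (1 + 2 \<delta>\<^sup>2 F / r)\<^sup>n - 1\<close>, where \<open>F\<close> counts the fixed points of a random permutation. As \<open>F\<close> has
  Poisson-like exponential moments, this is small unless \<open>n\<close> is of order \<open>r / \<epsilon>\<close>.
\<close>

section \<open>Spectral calculus\<close>

lemma mat_adjoint_carrier [simp]:
  assumes "A \<in> carrier_mat d d"
  shows "mat_adjoint A \<in> carrier_mat d d"
  using assms by (auto simp: mat_adjoint_def)

lemma mat_adjoint_index:
  assumes "A \<in> carrier_mat d d" "i < d" "j < d"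
  shows "mat_adjoint A $$ (i, j) = cnj (A $$ (j, i))"
  using assms by (auto simp: mat_adjoint_def mat_of_rows_index)

lemma mult_mat_index_sum:
  assumes "A \<in> carrier_mat d d" "B \<in> carrier_mat d d" "i < d" "j < d"
  shows "(A * B) $$ (i, j) = (\<Sum>k<d. A $$ (i, k) * B $$ (k, j))"
  using assms by (auto simp: scalar_prod_def lessThan_atLeast0)

text \<open>Test vectors are bare functions, so positivity applies to any function on indices
  without a carrier condition.\<close>

definition quad_form :: "nat \<Rightarrow> complex mat \<Rightarrow> (nat \<Rightarrow> complex) \<Rightarrow> real" where
  "quad_form d A f = Re (\<Sum>i<d. \<Sum>j<d. A $$ (i, j) * f j * cnj (f i))"

lemma quad_form_vec:
  assumes "A \<in> carrier_mat d d" "v \<in> carrier_vec d"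
  shows "Re ((A *\<^sub>v v) \<bullet>c v) = quad_form d A (\<lambda>i. v $ i)"
  using assms by (auto simp: quad_form_def scalar_prod_def lessThan_atLeast0 sum_distrib_right
      intro!: sum.cong)

lemma psd_mat_iff_quad_form:
  "psd_mat d A \<longleftrightarrow> hermitian_mat d A \<and> (\<forall>f. 0 \<le> quad_form d A f)"
proof -
  have "0 \<le> quad_form d A f"
    if "A \<in> carrier_mat d d" "\<forall>v \<in> carrier_vec d. 0 \<le> Re ((A *\<^sub>v v) \<bullet>c v)" for f
  proof -
    have "quad_form d A f = quad_form d A (\<lambda>i. vec d f $ i)"
      by (auto simp: quad_form_def intro!: sum.cong)
    also have "\<dots> = Re ((A *\<^sub>v vec d f) \<bullet>c vec d f)"
      using quad_form_vec[OF that(1), of "vec d f"] by simp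
    finally show ?thesis using that(2) by simp
  qed
  moreover have "0 \<le> Re ((A *\<^sub>v v) \<bullet>c v)"
    if "A \<in> carrier_mat d d" "\<forall>f. 0 \<le> quad_form d A f" "v \<in> carrier_vec d" for v
    unfolding quad_form_vec[OF that(1,3)] using that(2) by blast
  ultimately show ?thesis
    unfolding psd_mat_def hermitian_mat_def by meson
qed

lemma hermitian_matI:
  assumes "A \<in> carrier_mat d d" "\<And>i j. i < d \<Longrightarrow> j < d \<Longrightarrow> A $$ (j, i) = cnj (A $$ (i, j))"
  shows "hermitian_mat d A"
  unfolding hermitian_mat_def
proof
  show "mat_adjoint A = A"
  proof (rule eq_matI)
    fix i j assume "i < dim_row A" "j < dim_col A"
    hence "i < d" "j < d" using assms(1) by auto
    thus "mat_adjoint A $$ (i, j) = A $$ (i, j)"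
      using assms(2)[of j i] by (simp add: mat_adjoint_index[OF assms(1)])
  qed (use carrier_matD[OF assms(1)] carrier_matD[OF mat_adjoint_carrier[OF assms(1)]] in simp_all)
qed (fact assms(1))

lemma hermitian_mat_index:
  assumes "hermitian_mat d A" "i < d" "j < d"
  shows "A $$ (j, i) = cnj (A $$ (i, j))"
  using assms mat_adjoint_index[of A d j i] by (auto simp: hermitian_mat_def)

lemma spectral_mat_index:
  assumes "U \<in> carrier_mat d d" "i < d" "j < d"
  shows "(U * mat_diag d l * mat_adjoint U) $$ (i, j)
    = (\<Sum>k<d. U $$ (i, k) * l k * cnj (U $$ (j, k)))"
proof -
  have "U * mat_diag d l \<in> carrier_mat d d" using assms by auto
  from mult_mat_index_sum[OF this mat_adjoint_carrier[OF assms(1)] assms(2,3)]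
  show ?thesis using assms
    by (auto simp: mat_adjoint_index[OF assms(1)] mat_diag_mult_right[OF assms(1)])
qed

lemma unitary_mat_left_inverse:
  assumes "unitary_mat d U"
  shows "mat_adjoint U * U = 1\<^sub>m d"
  using assms mat_mult_left_right_inverse[of U d "mat_adjoint U"]
  by (auto simp: unitary_mat_def)

text \<open>\<open>W = V\<^sup>* U\<close> intertwines the two diagonal matrices, hence any function of them.\<close>

lemma spectral_function_unique:
  assumes U: "unitary_mat d U" and V: "unitary_mat d V"
    and eq: "U * mat_diag d l * mat_adjoint U = V * mat_diag d m * mat_adjoint V"
    and fg: "\<And>i j. l i = m j \<Longrightarrow> f i = g j"
  shows "U * mat_diag d f * mat_adjoint U = V * mat_diag d g * mat_adjoint (V :: complex mat)"
proof -
  have Uc: "U \<in> carrier_mat d d" and Vc: "V \<in> carrier_mat d d"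
    using U V by (auto simp: unitary_mat_def)
  define W where "W = mat_adjoint V * U"
  have mc: "A * B \<in> carrier_mat d d" if "A \<in> carrier_mat d d" "B \<in> carrier_mat d d"
    for A B :: "complex mat" using that by (rule mult_carrier_mat)
  have Wc: "W \<in> carrier_mat d d" unfolding W_def by (intro mc mat_adjoint_carrier Uc Vc)
  note car = mat_adjoint_carrier[OF Uc] mat_adjoint_carrier[OF Vc] Uc Vc mat_diag_dim mc
  note assoc = assoc_mult_mat[of _ d d _ d _ d]
  note one = left_mult_one_mat[of _ d d] right_mult_one_mat[of _ d d]
  note Ul = unitary_mat_left_inverse[OF U] and Vl = unitary_mat_left_inverse[OF V]
  have Ur: "U * mat_adjoint U = 1\<^sub>m d" and Vr: "V * mat_adjoint V = 1\<^sub>m d"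
    using U V by (simp_all add: unitary_mat_def)
  \<comment> \<open>Inserting \<open>mat_adjoint U * U = 1\<close> exposes the matrix that
    \<open>eq\<close> rewrites.\<close>
  have "W * mat_diag d l = mat_adjoint V * (U * mat_diag d l * (mat_adjoint U * U))"
    by (simp only: Ul one car W_def) (simp only: assoc car)
  also have "\<dots> = mat_adjoint V * ((U * mat_diag d l * mat_adjoint U) * U)"
    by (simp only: assoc car)
  also have "\<dots> = (mat_adjoint V * V) * (mat_diag d m * (mat_adjoint V * U))"
    unfolding eq by (simp only: assoc car)
  also have "\<dots> = mat_diag d m * W" by (simp only: Vl W_def one car)
  finally have inter: "W * mat_diag d l = mat_diag d m * W" .
  have "W * mat_diag d f = mat_diag d g * W"
  proof (rule eq_matI)
    fix i j assume "i < dim_row (mat_diag d g * W)" "j < dim_col (mat_diag d g * W)"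
    hence ij: "i < d" "j < d" using Wc by (auto simp: mat_diag_def)
    have "W $$ (i, j) * l j = m i * W $$ (i, j)"
      using arg_cong[OF inter, of "\<lambda>A. A $$ (i, j)"] ij
      by (simp add: mat_diag_mult_left[OF Wc] mat_diag_mult_right[OF Wc])
    \<comment> \<open>Either the entry of \<open>W\<close> vanishes or \<open>l j = m i\<close>, and
      then \<open>f j = g i\<close>.\<close>
    hence "W $$ (i, j) * f j = g i * W $$ (i, j)" using fg[of j i] by auto
    thus "(W * mat_diag d f) $$ (i, j) = (mat_diag d g * W) $$ (i, j)"
      using ij by (simp add: mat_diag_mult_left[OF Wc] mat_diag_mult_right[OF Wc])
  qed (use carrier_matD[OF Wc] in \<open>auto simp: mat_diag_def\<close>)
  hence "V * (W * mat_diag d f) * mat_adjoint U = V * (mat_diag d g * W) * mat_adjoint U" by simp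
  moreover have "V * (W * mat_diag d f) * mat_adjoint U
    = (V * mat_adjoint V) * (U * mat_diag d f * mat_adjoint U)"
    by (simp only: W_def assoc car)
  moreover have "V * (mat_diag d g * W) * mat_adjoint U
    = V * mat_diag d g * mat_adjoint V * (U * mat_adjoint U)"
    by (simp only: W_def assoc car)
  ultimately show ?thesis by (simp only: Ur Vr one car)
qed

text \<open>The choice in \<open>mat_powr\<close> ranges over all spectral decompositions of
  \<open>A\<close>. They yield the same matrix by uniqueness of the functional calculus, so any one
  of them computes the power.\<close>

lemma mat_powr_spectral:
  assumes "unitary_mat d U" "\<And>i. 0 \<le> lam i"
    and "A = U * mat_diag d (\<lambda>i. complex_of_real (lam i)) * mat_adjoint U"
  shows "mat_powr A a = U * mat_diag d (\<lambda>i. complex_of_real (lam i powr a)) * mat_adjoint U"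
proof -
  have d: "dim_row A = d" using assms by (auto simp: unitary_mat_def)
  show ?thesis unfolding mat_powr_def d
  proof (rule some_equality)
    show "\<exists>U' lam'. unitary_mat d U' \<and> (\<forall>i. 0 \<le> lam' i) \<and>
      A = U' * mat_diag d (\<lambda>i. complex_of_real (lam' i)) * mat_adjoint U' \<and>
      U * mat_diag d (\<lambda>i. complex_of_real (lam i powr a)) * mat_adjoint U =
      U' * mat_diag d (\<lambda>i. complex_of_real (lam' i powr a)) * mat_adjoint U'"
      using assms by blast
  next
    fix B
    assume "\<exists>U' lam'. unitary_mat d U' \<and> (\<forall>i. 0 \<le> lam' i) \<and>
      A = U' * mat_diag d (\<lambda>i. complex_of_real (lam' i)) * mat_adjoint U' \<and>
      B = U' * mat_diag d (\<lambda>i. complex_of_real (lam' i powr a)) * mat_adjoint U'"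
    then obtain U' lam' where *: "unitary_mat d U'"
      "A = U' * mat_diag d (\<lambda>i. complex_of_real (lam' i)) * mat_adjoint U'"
      "B = U' * mat_diag d (\<lambda>i. complex_of_real (lam' i powr a)) * mat_adjoint U'" by blast
    show "B = U * mat_diag d (\<lambda>i. complex_of_real (lam i powr a)) * mat_adjoint U"
      unfolding *(3)
      by (rule spectral_function_unique[OF *(1) assms(1) trans[OF *(2)[symmetric] assms(3)]]) simp
  qed
qed

lemma mat_adjoint_one: "mat_adjoint (1\<^sub>m d) = (1\<^sub>m d :: complex mat)"
  by (rule eq_matI) (auto simp: mat_adjoint_def mat_of_rows_index)

lemma mat_powr_mat_diag:
  assumes "\<And>i. 0 \<le> l i"
  shows "mat_powr (mat_diag d (\<lambda>i. complex_of_real (l i))) a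
    = mat_diag d (\<lambda>i. complex_of_real (l i powr a))"
proof -
  have "mat_diag d (\<lambda>i. complex_of_real (l i))
    = 1\<^sub>m d * mat_diag d (\<lambda>i. complex_of_real (l i)) * mat_adjoint (1\<^sub>m d)"
    by (simp add: mat_adjoint_one left_mult_one_mat[of _ d d] right_mult_one_mat[of _ d d])
  from mat_powr_spectral[OF _ assms this] show ?thesis
    by (simp add: unitary_mat_def mat_adjoint_one left_mult_one_mat[of _ d d] right_mult_one_mat[of _ d d])
qed

text \<open>In the eigenbasis the quadratic form is a sum of squared moduli with weights
  \<open>lam k\<close>, and the trace is the sum of the \<open>lam k\<close> because the columns of
  \<open>U\<close> are unit vectors.\<close>

lemma spectral_density_op:
  assumes "unitary_mat d U" "\<And>i. 0 \<le> lam i" "(\<Sum>i<d. lam i) = 1"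
    and "A = U * mat_diag d (\<lambda>i. complex_of_real (lam i)) * mat_adjoint U"
  shows "density_op d A"
proof -
  have Uc: "U \<in> carrier_mat d d" using assms by (auto simp: unitary_mat_def)
  have Ac: "A \<in> carrier_mat d d" unfolding assms(4)
    by (intro mult_carrier_mat[of _ d d]) (simp_all add: Uc)
  note ind = spectral_mat_index[OF Uc, of _ _ "\<lambda>i. complex_of_real (lam i)", folded assms(4)]
  have herm: "hermitian_mat d A"
    by (rule hermitian_matI[OF Ac]) (auto simp: ind mult_ac intro!: sum.cong)
  have "0 \<le> quad_form d A f" for f
  proof -
    have "(\<Sum>i<d. \<Sum>j<d. A $$ (i, j) * f j * cnj (f i))
      = (\<Sum>i<d. \<Sum>j<d. \<Sum>k<d. lam k * ((U $$ (i, k) * cnj (f i)) * cnj (U $$ (j, k) * cnj (f j))))"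
      by (auto simp: ind sum_distrib_right sum_distrib_left mult_ac intro!: sum.cong)
    also have "\<dots> = (\<Sum>k<d. \<Sum>i<d. \<Sum>j<d. lam k * ((U $$ (i, k) * cnj (f i)) * cnj (U $$ (j, k) * cnj (f j))))"
      by (subst sum.swap, rule sum.cong[OF refl], subst sum.swap) (rule refl)
    also have "\<dots> = (\<Sum>k<d. lam k * ((\<Sum>i<d. U $$ (i, k) * cnj (f i)) * cnj (\<Sum>i<d. U $$ (i, k) * cnj (f i))))"
      by (simp only: cnj_sum sum_product) (simp only: sum_distrib_left)
    also have "\<dots> = of_real (\<Sum>k<d. lam k * (cmod (\<Sum>i<d. U $$ (i, k) * cnj (f i)))\<^sup>2)"
      by (simp only: complex_norm_square[symmetric] of_real_sum of_real_mult of_real_power)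
    finally show ?thesis unfolding quad_form_def
      by (simp add: assms(2) sum_nonneg)
  qed
  hence psd: "psd_mat d A" using herm by (auto simp: psd_mat_iff_quad_form)
  have one: "(\<Sum>i<d. U $$ (i, k) * cnj (U $$ (i, k))) = 1" if "k < d" for k
    using arg_cong[OF unitary_mat_left_inverse[OF assms(1)], of "\<lambda>A. A $$ (k, k)"] that Uc
    by (simp add: mult_mat_index_sum[OF mat_adjoint_carrier[OF Uc] Uc that that]
        mat_adjoint_index[OF Uc] mult_ac)
  have "mtrace A = (\<Sum>i<d. \<Sum>k<d. U $$ (i, k) * lam k * cnj (U $$ (i, k)))"
    using Ac by (auto simp: mtrace_def ind)
  also have "\<dots> = (\<Sum>k<d. \<Sum>i<d. lam k * (U $$ (i, k) * cnj (U $$ (i, k))))"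
    by (subst sum.swap) (auto simp: mult_ac)
  also have "\<dots> = (\<Sum>k<d. complex_of_real (lam k))"
    by (simp only: sum_distrib_left[symmetric]) (simp add: one)
  also have "\<dots> = 1" using assms(3) by (simp flip: of_real_sum)
  finally show ?thesis using psd by (simp add: density_op_def)
qed

text \<open>Against a diagonal matrix only the diagonal of the power of \<open>A\<close> enters the
  trace; its entries are averages of \<open>lam k powr \<alpha>\<close> weighted by the squared
  moduli in a row of \<open>U\<close>.\<close>

lemma tsallis_spectral_diag:
  assumes "unitary_mat d U" "\<And>i. 0 \<le> lam i" "\<And>i. 0 \<le> s i"
    and "A = U * mat_diag d (\<lambda>i. complex_of_real (lam i)) * mat_adjoint U"
  shows "tsallis_rel_ent \<alpha> A (mat_diag d (\<lambda>i. complex_of_real (s i)))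
    = (1 - (\<Sum>i<d. (\<Sum>k<d. (cmod (U $$ (i, k)))\<^sup>2 * lam k powr \<alpha>) * s i powr (1 - \<alpha>))) / (1 - \<alpha>)"
proof -
  have Uc: "U \<in> carrier_mat d d" using assms by (auto simp: unitary_mat_def)
  define B where "B = U * mat_diag d (\<lambda>i. complex_of_real (lam i powr \<alpha>)) * mat_adjoint U"
  have Bc: "B \<in> carrier_mat d d" unfolding B_def
    by (intro mult_carrier_mat[of _ d d]) (simp_all add: Uc)
  note ind = spectral_mat_index[OF Uc, of _ _ "\<lambda>i. complex_of_real (lam i powr \<alpha>)", folded B_def]
  have "mtrace (B * mat_diag d (\<lambda>i. complex_of_real (s i powr (1 - \<alpha>))))
    = (\<Sum>i<d. B $$ (i, i) * s i powr (1 - \<alpha>))"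
    using Bc by (simp add: mtrace_def mat_diag_mult_right[OF Bc])
  also have "\<dots> = (\<Sum>i<d. (\<Sum>k<d. complex_of_real ((cmod (U $$ (i, k)))\<^sup>2) * complex_of_real (lam k powr \<alpha>))
      * complex_of_real (s i powr (1 - \<alpha>)))"
    by (intro sum.cong) (auto simp: ind complex_norm_square mult_ac simp del: of_real_power)
  also have "\<dots> = of_real (\<Sum>i<d. (\<Sum>k<d. (cmod (U $$ (i, k)))\<^sup>2 * lam k powr \<alpha>) * s i powr (1 - \<alpha>))"
    by simp
  finally show ?thesis
    unfolding tsallis_rel_ent_def mat_powr_mat_diag[OF assms(3)]
      mat_powr_spectral[OF assms(1,2,4)] B_def[symmetric] by simp
qed

section \<open>Tensor powers and joint measurements\<close>

text \<open>Quotient and remainder by \<open>e\<close> are the coordinates into which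
  \<open>kron\<close> splits an index.\<close>

lemma sum_div_mod:
  fixes f :: "nat \<Rightarrow> nat \<Rightarrow> 'a::comm_monoid_add"
  shows "(\<Sum>i<d * e. f (i div e) (i mod e)) = (\<Sum>a<d. \<Sum>b<e. f a b)"
proof (induction d)
  case (Suc d)
  have eq: "{..<Suc d * e} = {..<d * e} \<union> {d * e..<d * e + e}"
    using ivl_disj_un_one(2)[of "d * e" "d * e + e"] by (simp add: add.commute del: ivl_disj_un_one)
  have "(\<Sum>i<Suc d * e. f (i div e) (i mod e))
    = (\<Sum>i<d * e. f (i div e) (i mod e)) + (\<Sum>i=d*e..<d*e+e. f (i div e) (i mod e))"
    unfolding eq by (rule sum.union_disjoint) auto
  also have "(\<Sum>i=d*e..<d*e+e. f (i div e) (i mod e))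
    = (\<Sum>b=0..<e. f ((b + d * e) div e) ((b + d * e) mod e))"
    using sum.shift_bounds_nat_ivl[of "\<lambda>i. f (i div e) (i mod e)" 0 "d * e" e] by (simp add: add.commute)
  also have "\<dots> = (\<Sum>b<e. f d b)"
    unfolding lessThan_atLeast0 by (intro sum.cong) (auto simp: div_mult_self3)
  finally show ?case using Suc by simp
qed simp

text \<open>Entries of a tensor power, read off from base-\<open>d\<close> digits with the leading
  digit first, as in \<open>kron\<close>. The kernels are real because every state of the
  construction has real entries.\<close>

fun tensor_kernel :: "nat \<Rightarrow> (nat \<Rightarrow> nat \<Rightarrow> real) \<Rightarrow> nat \<Rightarrow> nat \<Rightarrow> nat \<Rightarrow> real" where
  "tensor_kernel d t 0 i j = 1"
| "tensor_kernel d t (Suc n) i j =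
     t (i div d ^ n) (j div d ^ n) * tensor_kernel d t n (i mod d ^ n) (j mod d ^ n)"

fun tensor_fun :: "nat \<Rightarrow> (nat \<Rightarrow> real) \<Rightarrow> nat \<Rightarrow> nat \<Rightarrow> real" where
  "tensor_fun d v 0 i = 1"
| "tensor_fun d v (Suc n) i = v (i div d ^ n) * tensor_fun d v n (i mod d ^ n)"

definition kernel_mat :: "nat \<Rightarrow> (nat \<Rightarrow> nat \<Rightarrow> real) \<Rightarrow> complex mat" where
  "kernel_mat d t = mat d d (\<lambda>(i, j). complex_of_real (t i j))"

lemma tensor_pow_kernel_mat:
  "tensor_pow (kernel_mat d t) n = kernel_mat (d ^ n) (tensor_kernel d t n)"
proof (induction n)
  case 0
  show ?case by (rule eq_matI) (auto simp: kernel_mat_def)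
next
  case (Suc n)
  have aux: "i div e < d \<and> i mod e < e" if "i < d * e" for i e :: nat
  proof -
    have "0 < e" using that by (cases e) auto
    thus ?thesis using that by (auto simp: less_mult_imp_div_less)
  qed
  show ?case unfolding tensor_pow.simps Suc
    by (rule eq_matI) (auto simp: kernel_mat_def kron_def aux)
qed

lemma tensor_kernel_product:
  "tensor_kernel d (\<lambda>i j. v i * v j) n i j = tensor_fun d v n i * tensor_fun d v n j"
  by (induction n arbitrary: i j) auto

lemma tensor_kernel_scaled_identity:
  "tensor_kernel d (\<lambda>i j. if i = j then c else 0) n i j = (if i = j then c ^ n else 0)"
  if "i < d ^ n" "j < d ^ n"
  using that
proof (induction n arbitrary: i j)
  case (Suc n)
  have "0 < d ^ n" using Suc.prems by (cases "d = 0") auto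
  moreover have "i = j \<longleftrightarrow> i div d ^ n = j div d ^ n \<and> i mod d ^ n = j mod d ^ n"
    by (metis div_mult_mod_eq)
  ultimately show ?case using Suc.IH[of "i mod d ^ n" "j mod d ^ n"] by auto
qed auto

text \<open>Hilbert-Schmidt inner products are multiplicative over tensor factors: pairing leading
  digits with leading digits factors the double sum.\<close>

lemma tensor_kernel_inner:
  "(\<Sum>i<d ^ n. \<Sum>j<d ^ n. tensor_kernel d t n i j * tensor_kernel d u n i j)
    = (\<Sum>i<d. \<Sum>j<d. t i j * u i j) ^ n"
proof (induction n)
  case (Suc n)
  define e where "e = d ^ n"
  define T where "T a b = t a b * u a b" for a b
  define F where "F a b = tensor_kernel d t n a b * tensor_kernel d u n a b" for a b
  have "(\<Sum>i<d ^ Suc n. \<Sum>j<d ^ Suc n. tensor_kernel d t (Suc n) i j * tensor_kernel d u (Suc n) i j)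
    = (\<Sum>i<d * e. \<Sum>j<d * e. T (i div e) (j div e) * F (i mod e) (j mod e))"
    by (simp add: e_def T_def F_def mult_ac)
  also have "\<dots> = (\<Sum>a<d. \<Sum>b<e. \<Sum>a'<d. \<Sum>b'<e. T a a' * F b b')"
    by (simp only: sum_div_mod[of "\<lambda>a' b'. T _ a' * F _ b'"]
       sum_div_mod[of "\<lambda>a b. \<Sum>a'<d. \<Sum>b'<e. T a a' * F b b'"])
  also have "\<dots> = (\<Sum>a<d. \<Sum>a'<d. \<Sum>b<e. \<Sum>b'<e. T a a' * F b b')"
    by (intro sum.cong sum.swap refl)
  also have "\<dots> = (\<Sum>a<d. \<Sum>a'<d. T a a') * (\<Sum>b<e. \<Sum>b'<e. F b b')"
    by (simp only: sum_distrib_right) (simp only: sum_distrib_left)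
  finally show ?case using Suc by (simp add: e_def T_def F_def)
qed simp

lemma tensor_kernel_trace:
  "(\<Sum>i<d ^ n. tensor_kernel d t n i i) = (\<Sum>i<d. t i i) ^ n"
proof (induction n)
  case (Suc n)
  have "(\<Sum>i<d ^ Suc n. tensor_kernel d t (Suc n) i i)
    = (\<Sum>a<d. \<Sum>b<d ^ n. t a a * tensor_kernel d t n b b)"
    using sum_div_mod[of "\<lambda>a b. t a a * tensor_kernel d t n b b" "d ^ n" d]
    by (simp only: tensor_kernel.simps power_Suc)
  also have "\<dots> = (\<Sum>i<d. t i i) * (\<Sum>b<d ^ n. tensor_kernel d t n b b)"
    by (simp only: sum_distrib_right) (simp only: sum_distrib_left)
  finally show ?case using Suc by simp
qed simp

lemma tensor_fun_inner:
  "(\<Sum>i<d ^ n. tensor_fun d v n i * tensor_fun d w n i) = (\<Sum>i<d. v i * w i) ^ n"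
proof -
  \<comment> \<open>The inner product is the trace of the rank-one kernel
    \<open>v i * w j\<close>.\<close>
  have "tensor_kernel d (\<lambda>i j. v i * w j) n i j = tensor_fun d v n i * tensor_fun d w n j" for i j
    by (induction n arbitrary: i j) auto
  thus ?thesis using tensor_kernel_trace[of d "\<lambda>i j. v i * w j" n] by simp
qed

section \<open>Real parts of measurement operators and state discrimination\<close>

definition real_form :: "nat \<Rightarrow> (nat \<Rightarrow> nat \<Rightarrow> real) \<Rightarrow> (nat \<Rightarrow> real) \<Rightarrow> real" where
  "real_form D E f = (\<Sum>i<D. \<Sum>j<D. E i j * f i * f j)"

lemma real_form_lincomb:
  "real_form D E (\<lambda>i. a * f i + b * g i) = a\<^sup>2 * real_form D E f + b\<^sup>2 * real_form D E g
     + a * b * (\<Sum>i<D. \<Sum>j<D. E i j * (f i * g j + g i * f j))"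
  unfolding real_form_def sum_distrib_left sum.distrib[symmetric]
  by (intro sum.cong refl) (simp add: algebra_simps power2_eq_square)

text \<open>The effect of the event \<open>S\<close>, reduced to its real part: against a state with
  real entries the imaginary part never reaches the probability.\<close>

definition outcome_kernel :: "(nat \<Rightarrow> complex mat) \<Rightarrow> nat set \<Rightarrow> nat \<Rightarrow> nat \<Rightarrow> real" where
  "outcome_kernel M S i j = (\<Sum>k\<in>S. Re (M k $$ (i, j)))"

lemma real_form_outcome_kernel:
  "real_form D (outcome_kernel M S) f = (\<Sum>k\<in>S. quad_form D (M k) (\<lambda>i. complex_of_real (f i)))"
proof -
  have "real_form D (outcome_kernel M S) f
    = (\<Sum>i<D. \<Sum>j<D. \<Sum>k\<in>S. Re (M k $$ (i, j)) * f i * f j)"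
    by (simp add: real_form_def outcome_kernel_def sum_distrib_right)
  also have "\<dots> = (\<Sum>k\<in>S. \<Sum>i<D. \<Sum>j<D. Re (M k $$ (i, j)) * f i * f j)"
    by (simp only: sum.swap[of _ S])
  finally show ?thesis by (simp add: quad_form_def mult_ac)
qed

lemma outcome_kernel_nonneg:
  assumes "povm D K M" "S \<subseteq> {..<K}"
  shows "0 \<le> real_form D (outcome_kernel M S) f"
  unfolding real_form_outcome_kernel
  using assms by (intro sum_nonneg) (auto simp: povm_def psd_mat_iff_quad_form)

lemma outcome_kernel_sym:
  assumes "povm D K M" "S \<subseteq> {..<K}" "i < D" "j < D"
  shows "outcome_kernel M S j i = outcome_kernel M S i j"
  unfolding outcome_kernel_def
proof (rule sum.cong[OF refl])
  fix k assume "k \<in> S"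
  hence "hermitian_mat D (M k)" using assms by (auto simp: povm_def psd_mat_def)
  from hermitian_mat_index[OF this assms(3,4)]
  show "Re (M k $$ (j, i)) = Re (M k $$ (i, j))" by simp
qed

text \<open>Effects of disjoint events add up to at most the identity: outcomes outside
  \<open>S \<union> T\<close> contribute nonnegative forms, and all outcomes together give the
  squared norm.\<close>

lemma outcome_kernel_add_le:
  assumes "povm D K M" "S \<subseteq> {..<K}" "T \<subseteq> {..<K}" "S \<inter> T = {}"
  shows "real_form D (outcome_kernel M S) f + real_form D (outcome_kernel M T) f \<le> (\<Sum>i<D. (f i)\<^sup>2)"
proof -
  have fin: "finite S" "finite T" using assms finite_subset by blast+
  have "real_form D (outcome_kernel M S) f + real_form D (outcome_kernel M T) f
    = (\<Sum>k\<in>S \<union> T. quad_form D (M k) (\<lambda>i. complex_of_real (f i)))"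
    unfolding real_form_outcome_kernel using fin assms(4) by (simp add: sum.union_disjoint)
  also have "\<dots> \<le> (\<Sum>k<K. quad_form D (M k) (\<lambda>i. complex_of_real (f i)))"
    using assms by (intro sum_mono2) (auto simp: povm_def psd_mat_iff_quad_form)
  also have "\<dots> = real_form D (outcome_kernel M {..<K}) f" by (simp add: real_form_outcome_kernel)
  also have "\<dots> = (\<Sum>i<D. \<Sum>j<D. if i = j then f i * f j else 0)"
    unfolding real_form_def
  proof (intro sum.cong refl)
    fix i j assume "i \<in> {..<D}" "j \<in> {..<D}"
    hence "(\<Sum>k<K. M k $$ (i, j)) = (if i = j then 1 else 0)" using assms(1) by (simp add: povm_def)
    hence "Re (\<Sum>k<K. M k $$ (i, j)) = (if i = j then 1 else 0)" by simp
    thus "outcome_kernel M {..<K} i j * f i * f j = (if i = j then f i * f j else 0)"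
      by (simp add: outcome_kernel_def)
  qed
  also have "\<dots> = (\<Sum>i<D. (f i)\<^sup>2)" by (simp add: power2_eq_square)
  finally show ?thesis .
qed

lemma success_prob_kernel_mat:
  assumes "povm (d ^ n) K M"
  shows "success_prob n K M x (kernel_mat d t) y \<epsilon>
    = (\<Sum>i<d ^ n. \<Sum>j<d ^ n. outcome_kernel M {k. k < K \<and> \<bar>x k - y\<bar> \<le> \<epsilon>} i j
        * tensor_kernel d t n j i)"
proof -
  let ?S = "{k. k < K \<and> \<bar>x k - y\<bar> \<le> \<epsilon>}"
  let ?D = "d ^ n"
  have "Re (mtrace (M k * tensor_pow (kernel_mat d t) n))
    = (\<Sum>i<?D. \<Sum>j<?D. Re (M k $$ (i, j)) * tensor_kernel d t n j i)" if "k < K" for k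
  proof -
    have c: "M k \<in> carrier_mat ?D ?D"
      using assms that by (auto simp: povm_def psd_mat_def hermitian_mat_def)
    have c': "kernel_mat ?D (tensor_kernel d t n) \<in> carrier_mat ?D ?D" by (simp add: kernel_mat_def)
    show ?thesis using c c' unfolding mtrace_def tensor_pow_kernel_mat
      by (simp add: mult_mat_index_sum[OF c c'] del: index_mult_mat(1))
         (simp add: kernel_mat_def)
  qed
  hence "success_prob n K M x (kernel_mat d t) y \<epsilon>
    = (\<Sum>k\<in>?S. \<Sum>i<?D. \<Sum>j<?D. Re (M k $$ (i, j)) * tensor_kernel d t n j i)"
    unfolding success_prob_def by (intro sum.cong) auto
  also have "\<dots> = (\<Sum>i<?D. \<Sum>j<?D. \<Sum>k\<in>?S. Re (M k $$ (i, j)) * tensor_kernel d t n j i)"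
    by (simp only: sum.swap[of _ "{..<d ^ n}" ?S])
  finally show ?thesis by (simp add: outcome_kernel_def sum_distrib_right)
qed

text \<open>The square root of the form of an effect is a seminorm dominated by the Euclidean norm.
  For \<open>S\<close> it is at least \<open>sqrt (2 / 3)\<close> at \<open>v\<close> and at most
  \<open>sqrt (1 / 3)\<close> at \<open>w\<close>, which keeps the vectors apart.\<close>

lemma pure_state_discrimination:
  assumes M: "povm D K M" and ST: "S \<subseteq> {..<K}" "T \<subseteq> {..<K}" "S \<inter> T = {}"
    and unit: "(\<Sum>i<D. (w i)\<^sup>2) = 1"
    and v: "2 / 3 \<le> real_form D (outcome_kernel M S) v"
    and w: "2 / 3 \<le> real_form D (outcome_kernel M T) w"
  shows "1 / 18 \<le> (\<Sum>i<D. (v i - w i)\<^sup>2)"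
proof -
  let ?q = "real_form D (outcome_kernel M S)"
  define b where "b = (\<Sum>i<D. \<Sum>j<D. outcome_kernel M S i j * (v i * w j + w i * v j))"
  have "?q w \<le> 1 / 3" using outcome_kernel_add_le[OF M ST, of w] unit w by simp
  moreover have "?q (\<lambda>i. v i - w i) \<le> (\<Sum>i<D. (v i - w i)\<^sup>2)"
    using outcome_kernel_add_le[OF M ST, of "\<lambda>i. v i - w i"]
      outcome_kernel_nonneg[OF M ST(2), of "\<lambda>i. v i - w i"] by simp
  moreover have "?q (\<lambda>i. v i - w i) = ?q v + ?q w - b"
    using real_form_lincomb[of D "outcome_kernel M S" 1 v "-1" w] by (simp add: b_def)
  \<comment> \<open>Positivity at \<open>2 v - 3 w\<close>, where 3 / 2 stands in for the optimal
    \<open>sqrt 2\<close>, gives \<open>b \<le> 2 / 3 * ?q v + 3 / 2 * ?q w\<close>. The form at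
    \<open>v - w\<close> is then at least \<open>?q v / 3 - ?q w / 2\<close>, and
    \<open>2 / 9 - 1 / 6 = 1 / 18\<close>.\<close>
  moreover have "0 \<le> 4 * ?q v + 9 * ?q w - 6 * b"
    using real_form_lincomb[of D "outcome_kernel M S" 2 v "-3" w]
      outcome_kernel_nonneg[OF M ST(1), of "\<lambda>i. 2 * v i + - 3 * w i"] by (simp add: b_def)
  ultimately show ?thesis using v by linarith
qed

text \<open>Positivity of \<open>E\<close> at \<open>e\<^sub>i - E e\<^sub>i\<close> gives \<open>\<parallel>E e\<^sub>i\<parallel>\<^sup>2 \<le> E\<^sub>i\<^sub>i\<close>.\<close>

lemma outcome_kernel_row_le:
  assumes M: "povm D K M" and S: "S \<subseteq> {..<K}" and i: "i < D"
  shows "(\<Sum>j<D. (outcome_kernel M S i j)\<^sup>2) \<le> 1"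
proof -
  let ?E = "outcome_kernel M S"
  define e :: "nat \<Rightarrow> real" where "e a = (if a = i then 1 else 0)" for a
  define s where "s = (\<Sum>j<D. (?E i j)\<^sup>2)"
  have le: "real_form D ?E f \<le> (\<Sum>i<D. (f i)\<^sup>2)" for f
    using outcome_kernel_add_le[OF M S, of "{}" f] by (simp add: real_form_outcome_kernel)
  have "(\<Sum>j<D. (e j)\<^sup>2) = 1" using i by (simp add: e_def if_distrib[of "\<lambda>x. x\<^sup>2"] cong: if_cong)
  hence 1: "real_form D ?E e \<le> 1" using le[of e] by simp
  have "(\<Sum>a<D. \<Sum>b<D. ?E a b * (e a * ?E i b + ?E i a * e b))
    = (\<Sum>a<D. \<Sum>b<D. ?E a b * e a * ?E i b) + (\<Sum>b<D. \<Sum>a<D. ?E a b * ?E i a * e b)"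
    by (simp add: sum.distrib algebra_simps) (rule sum.swap)
  also have "(\<Sum>a<D. \<Sum>b<D. ?E a b * e a * ?E i b) = (\<Sum>a<D. if a = i then s else 0)"
    by (intro sum.cong) (auto simp: e_def s_def power2_eq_square)
  also have "\<dots> = s" using i by simp
  also have "(\<Sum>b<D. \<Sum>a<D. ?E a b * ?E i a * e b) = (\<Sum>b<D. if b = i then s else 0)"
    using outcome_kernel_sym[OF M S i]
    by (intro sum.cong) (auto simp: e_def s_def power2_eq_square intro!: sum.cong)
  also have "\<dots> = s" using i by simp
  finally have cross: "(\<Sum>a<D. \<Sum>b<D. ?E a b * (e a * ?E i b + ?E i a * e b)) = 2 * s" by simp
  have "0 \<le> real_form D ?E e + real_form D ?E (?E i) - 2 * s"
    using outcome_kernel_nonneg[OF M S, of "\<lambda>a. 1 * e a + - 1 * ?E i a"]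
    unfolding real_form_lincomb cross by simp
  \<comment> \<open>The form at the row is at most \<open>s\<close>, so
    \<open>0 \<le> 1 + s - 2 * s\<close>.\<close>
  with 1 le[of "?E i"] show ?thesis by (simp add: s_def)
qed

text \<open>The second-moment method with the maximally mixed state as reference: on the trace of an
  outcome against the averaged perturbation, Cauchy--Schwarz in Hilbert--Schmidt norm suffices,
  because outcomes have squared norm at most \<open>d\<^sup>n\<close>.\<close>

lemma mixture_vs_maximally_mixed:
  assumes M: "povm (d ^ n) K M" and ST: "S \<subseteq> {..<K}" "T \<subseteq> {..<K}" "S \<inter> T = {}"
    and d: "0 < d" and P: "finite P" "P \<noteq> {}"
    and tr: "\<And>p. p \<in> P \<Longrightarrow> (\<Sum>i<d. t p i i) = 1"
    and mixed: "2 / 3 \<le> (\<Sum>i<d ^ n. \<Sum>j<d ^ n. outcome_kernel M S i j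
        * tensor_kernel d (\<lambda>i j. if i = j then 1 / real d else 0) n j i)"
    and perturbed: "\<And>p. p \<in> P \<Longrightarrow>
      2 / 3 \<le> (\<Sum>i<d ^ n. \<Sum>j<d ^ n. outcome_kernel M T i j * tensor_kernel d (t p) n j i)"
  shows "10 / 9 * (real (card P))\<^sup>2
    \<le> (\<Sum>p\<in>P. \<Sum>q\<in>P. (real d * (\<Sum>i<d. \<Sum>j<d. t p i j * t q i j)) ^ n)"
proof -
  define D where "D = d ^ n"
  define N where "N = real (card P)"
  define X where "X p = tensor_kernel d (t p) n" for p
  define I where "I i j = (if i = j then 1 / real D else 0)" for i j :: nat
  define R where "R i j = (\<Sum>p\<in>P. X p i j)" for i j
  define \<Delta> where "\<Delta> i j = R i j / N - I i j" for i j
  let ?E = "outcome_kernel M T"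
  have D0: "0 < D" and N0: "0 < N" using d P by (auto simp: D_def N_def card_gt_0_iff)
  have ref: "tensor_kernel d (\<lambda>i j. if i = j then 1 / real d else 0) n i j = I i j"
    if "i < D" "j < D" for i j
    using that tensor_kernel_scaled_identity[of i d n j "1 / real d"]
    by (simp add: I_def D_def power_one_over)
  have trI: "(\<Sum>i<D. \<Sum>j<D. F i j * I j i) = (\<Sum>i<D. F i i) / D" for F :: "nat \<Rightarrow> nat \<Rightarrow> real"
    by (simp add: I_def sum_divide_distrib if_distrib[of "\<lambda>x. _ * x"] cong: if_cong)
  have diag: "F i i = real_form D F (\<lambda>a. if a = i then 1 else 0)" if "i < D"
    for F :: "nat \<Rightarrow> nat \<Rightarrow> real" and i
    using that by (simp add: real_form_def if_distrib[of "\<lambda>x. _ * x"] cong: if_cong)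
  \<comment> \<open>Testing on basis vectors bounds the two traces together by \<open>D\<close>.
    Success on the mixed state forces the trace for \<open>S\<close> up to \<open>2 / 3 * D\<close>,
    which leaves probability at most 1 / 3 for \<open>T\<close> there.\<close>
  have "(\<Sum>i<D. outcome_kernel M S i i + ?E i i) \<le> (\<Sum>i<D. 1)"
  proof (rule sum_mono)
    fix i assume "i \<in> {..<D}"
    hence i: "i < D" by simp
    have "(\<Sum>a<D. (if a = i then 1 else 0 :: real)\<^sup>2) = 1"
      using i by (simp add: if_distrib[of "\<lambda>x. x\<^sup>2"] cong: if_cong)
    thus "outcome_kernel M S i i + ?E i i \<le> 1"
      using outcome_kernel_add_le[OF M ST, of "\<lambda>a. if a = i then 1 else 0"]
      by (simp add: diag[OF i] D_def)
  qed
  moreover have "2 / 3 \<le> (\<Sum>i<D. outcome_kernel M S i i) / D"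
    using mixed unfolding trI[symmetric] D_def[symmetric] by (simp add: ref)
  ultimately have E0: "(\<Sum>i<D. \<Sum>j<D. ?E i j * I j i) \<le> 1 / 3"
    unfolding trI using D0 by (simp add: sum.distrib field_simps)
  have "2 / 3 * N = (\<Sum>p\<in>P. 2 / 3)" by (simp add: N_def)
  also have "\<dots> \<le> (\<Sum>p\<in>P. \<Sum>i<D. \<Sum>j<D. ?E i j * X p j i)"
    using perturbed by (intro sum_mono) (simp add: X_def D_def)
  also have "\<dots> = (\<Sum>i<D. \<Sum>j<D. ?E i j * R j i)"
    by (simp only: R_def sum_distrib_left sum.swap[of _ _ P])
  finally have "2 / 3 \<le> (\<Sum>i<D. \<Sum>j<D. ?E i j * R j i) / N" using N0 by (simp add: field_simps)
  also have "\<dots> = (\<Sum>i<D. \<Sum>j<D. ?E i j * \<Delta> j i) + (\<Sum>i<D. \<Sum>j<D. ?E i j * I j i)"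
    by (simp add: \<Delta>_def sum_divide_distrib sum.distrib[symmetric] algebra_simps)
  finally have "1 / 3 \<le> (\<Sum>i<D. \<Sum>j<D. ?E i j * \<Delta> j i)" using E0 by simp
  \<comment> \<open>The weights in this AM-GM split make the first part total at most 1 / 6, half of
    the required 1 / 3, as the squared entries of \<open>?E\<close> sum to at most
    \<open>D\<close>.\<close>
  also have "\<dots> \<le> (\<Sum>i<D. \<Sum>j<D. (?E i j)\<^sup>2 / (6 * D) + 3 * D / 2 * (\<Delta> j i)\<^sup>2)"
  proof (intro sum_mono)
    fix i j
    have "0 \<le> (?E i j - 3 * D * \<Delta> j i)\<^sup>2 / (6 * D)" using D0 by simp
    also have "\<dots> = (?E i j)\<^sup>2 / (6 * D) + 3 * D / 2 * (\<Delta> j i)\<^sup>2 - ?E i j * \<Delta> j i"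
      using D0 by (simp add: power2_eq_square field_simps)
    finally show "?E i j * \<Delta> j i \<le> (?E i j)\<^sup>2 / (6 * D) + 3 * D / 2 * (\<Delta> j i)\<^sup>2" by simp
  qed
  also have "\<dots> = (\<Sum>i<D. \<Sum>j<D. (?E i j)\<^sup>2) / (6 * D) + 3 * D / 2 * (\<Sum>i<D. \<Sum>j<D. (\<Delta> j i)\<^sup>2)"
    by (simp add: sum.distrib sum_divide_distrib sum_distrib_left)
  also have "(\<Sum>i<D. \<Sum>j<D. (?E i j)\<^sup>2) \<le> (\<Sum>i<D. 1)"
    using outcome_kernel_row_le[OF M ST(2)] by (intro sum_mono) (auto simp: D_def)
  also have "(\<Sum>i<D. 1) = real D" by simp
  finally have "1 / 9 \<le> D * (\<Sum>i<D. \<Sum>j<D. (\<Delta> j i)\<^sup>2)"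
    using D0 by (simp add: divide_right_mono)
  also have "(\<Sum>i<D. \<Sum>j<D. (\<Delta> j i)\<^sup>2) = (\<Sum>j<D. \<Sum>i<D. (\<Delta> j i)\<^sup>2)" by (rule sum.swap)
  \<comment> \<open>All traces are 1, so the cross term is \<open>- 2 / D\<close> and the last one
    \<open>1 / D\<close>. Multiplied by \<open>D\<close>, the square is the normalized second moment
    minus 1, whence \<open>10 / 9 = 1 + 1 / 9\<close>.\<close>
  also have "\<dots> = (\<Sum>i<D. \<Sum>j<D. (R i j)\<^sup>2) / N\<^sup>2 - 2 * (\<Sum>i<D. \<Sum>j<D. R i j * I j i) / N
      + (\<Sum>i<D. \<Sum>j<D. I i j * I j i)"
    unfolding sum_divide_distrib sum_distrib_left sum.distrib[symmetric] sum_subtractf[symmetric]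
    by (intro sum.cong refl) (auto simp: \<Delta>_def I_def power2_eq_square algebra_simps)
  also have "(\<Sum>i<D. \<Sum>j<D. I i j * I j i) = 1 / D" using D0 by (simp add: trI) (simp add: I_def)
  also have "(\<Sum>i<D. \<Sum>j<D. R i j * I j i) = N / D"
  proof -
    have "(\<Sum>i<D. R i i) = (\<Sum>p\<in>P. \<Sum>i<D. X p i i)" unfolding R_def by (rule sum.swap)
    also have "\<dots> = (\<Sum>p\<in>P. 1)"
      by (intro sum.cong) (auto simp: X_def D_def tensor_kernel_trace tr)
    finally show ?thesis by (simp add: trI N_def)
  qed
  also have "(\<Sum>i<D. \<Sum>j<D. (R i j)\<^sup>2) = (\<Sum>p\<in>P. \<Sum>q\<in>P. (\<Sum>i<d. \<Sum>j<d. t p i j * t q i j) ^ n)"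
  proof -
    have "(\<Sum>i<D. \<Sum>j<D. (R i j)\<^sup>2) = (\<Sum>i<D. \<Sum>j<D. \<Sum>p\<in>P. \<Sum>q\<in>P. X p i j * X q i j)"
      by (simp add: R_def power2_eq_square sum_product)
    also have "\<dots> = (\<Sum>p\<in>P. \<Sum>q\<in>P. \<Sum>i<D. \<Sum>j<D. X p i j * X q i j)"
      by (simp only: sum.swap[of _ P "{..<D}"])
    finally show ?thesis by (simp only: X_def D_def tensor_kernel_inner)
  qed
  finally have "1 / 9 \<le> D * (\<Sum>p\<in>P. \<Sum>q\<in>P. (\<Sum>i<d. \<Sum>j<d. t p i j * t q i j) ^ n) / N\<^sup>2 - 1"
    using D0 N0 by (simp add: field_simps)
  hence "10 / 9 * N\<^sup>2 \<le> D * (\<Sum>p\<in>P. \<Sum>q\<in>P. (\<Sum>i<d. \<Sum>j<d. t p i j * t q i j) ^ n)"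
    using N0 by (simp add: field_simps)
  thus ?thesis
    by (simp only: power_mult_distrib sum_distrib_left[symmetric] D_def N_def of_nat_power)
qed

section \<open>Random permutations and two-level states\<close>

lemma sum_powers_of_subsets:
  fixes x :: real
  assumes "finite F"
  shows "(\<Sum>S\<in>Pow F. x ^ card S) = (1 + x) ^ card F"
  using prod_add[OF assms, of "\<lambda>_. x" "\<lambda>_. 1"] by (simp add: add.commute)

lemma sum_power_le_exp:
  fixes x :: real
  assumes "0 \<le> x"
  shows "(\<Sum>k\<le>n. x ^ k / fact k) \<le> exp x"
proof -
  have "(\<lambda>k. x ^ k / fact k) sums exp x"
    using exp_converges[of x] by (simp add: divide_inverse mult.commute)
  thus ?thesis
    using assms sum_le_suminf[of "\<lambda>k. x ^ k / fact k" "{..n}"] by (simp add: sums_iff)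
qed

text \<open>Expand \<open>1 + x\<close> over sets of fixed points; after division by \<open>|A|!\<close> the bound is the moment
  of a Poisson variable of mean 1.\<close>

lemma permutation_fixed_points_moment:
  fixes x :: real
  assumes A: "finite A" and x: "0 \<le> x"
  shows "(\<Sum>p | p permutes A. (1 + x) ^ card {a \<in> A. p a = a}) \<le> fact (card A) * exp x"
proof -
  let ?P = "{p. p permutes A}"
  have fin: "finite ?P" by (rule finite_permutations[OF A])
  have "(\<Sum>p\<in>?P. (1 + x) ^ card {a \<in> A. p a = a})
    = (\<Sum>p\<in>?P. \<Sum>S\<in>Pow A. if \<forall>a\<in>S. p a = a then x ^ card S else 0)"
  proof (rule sum.cong[OF refl])
    fix p
    have "Pow {a \<in> A. p a = a} = {S \<in> Pow A. \<forall>a\<in>S. p a = a}" by auto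
    thus "(1 + x) ^ card {a \<in> A. p a = a}
      = (\<Sum>S\<in>Pow A. if \<forall>a\<in>S. p a = a then x ^ card S else 0)"
      using sum_powers_of_subsets[of "{a \<in> A. p a = a}" x] A
      by (simp only: sum.inter_filter finite_Pow_iff) simp
  qed
  also have "\<dots> = (\<Sum>S\<in>Pow A. \<Sum>p\<in>?P. if \<forall>a\<in>S. p a = a then x ^ card S else 0)"
    by (rule sum.swap)
  also have "\<dots> = (\<Sum>S\<in>Pow A. fact (card A - card S) * x ^ card S)"
  proof (rule sum.cong[OF refl])
    fix S assume S: "S \<in> Pow A"
    have "{p \<in> ?P. \<forall>a\<in>S. p a = a} = {p. p permutes (A - S)}"
      using S by (auto simp: permutes_def)
    moreover have "card {p. p permutes (A - S)} = fact (card A - card S)"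
      using S A by (intro card_permutations) (auto simp: card_Diff_subset finite_subset)
    ultimately show "(\<Sum>p\<in>?P. if \<forall>a\<in>S. p a = a then x ^ card S else 0)
      = fact (card A - card S) * x ^ card S"
      using fin by (simp flip: sum.inter_filter)
  qed
  also have "\<dots> = (\<Sum>k\<le>card A. \<Sum>S\<in>{S\<in>Pow A. card S = k}. fact (card A - card S) * x ^ card S)"
    by (rule sum.group[symmetric]) (use A in \<open>auto simp: card_mono\<close>)
  \<comment> \<open>With \<open>N = card A\<close>, the sets of size \<open>k\<close> contribute
    \<open>(N choose k) * (N - k)! = N! / k!\<close> times \<open>x ^ k\<close>.\<close>
  also have "\<dots> = (\<Sum>k\<le>card A. of_nat (card A choose k) * (fact (card A - k) * x ^ k))"
    using n_subsets[OF A] by (intro sum.cong) (auto simp: Pow_def)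
  also have "\<dots> = fact (card A) * (\<Sum>k\<le>card A. x ^ k / fact k)"
    unfolding sum_distrib_left by (intro sum.cong) (auto simp: binomial_fact)
  also have "\<dots> \<le> fact (card A) * exp x"
    by (intro mult_left_mono sum_power_le_exp x) simp
  finally show ?thesis .
qed

text \<open>Replacing \<open>q\<close> by \<open>p \<circ> q\<close> permutes the summation range
  and turns agreements of \<open>p\<close> and \<open>q\<close> into fixed points, so one bound
  serves every \<open>p\<close>.\<close>

lemma permutation_agreement_moment:
  fixes x :: real
  assumes A: "finite A" and x: "0 \<le> x"
  shows "(\<Sum>p | p permutes A. \<Sum>q | q permutes A. (1 + x) ^ card {a \<in> A. p a = q a})
    \<le> (fact (card A))\<^sup>2 * exp x"
proof -
  have "(\<Sum>q | q permutes A. (1 + x) ^ card {a \<in> A. p a = q a}) \<le> fact (card A) * exp x"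
    if "p permutes A" for p
  proof -
    have "{a \<in> A. p a = (p \<circ> q) a} = {a \<in> A. q a = a}" for q
      using permutes_inj[OF that] by (auto simp: inj_eq)
    thus ?thesis
      using permutation_fixed_points_moment[OF A x]
      by (simp only: setum_permutations_compose_left[OF that, of "\<lambda>q. (1 + x) ^ card {a \<in> A. p a = q a}"])
  qed
  hence "(\<Sum>p | p permutes A. \<Sum>q | q permutes A. (1 + x) ^ card {a \<in> A. p a = q a})
    \<le> (\<Sum>p | p permutes A. fact (card A) * exp x)"
    by (intro sum_mono) simp
  also have "\<dots> = (fact (card A))\<^sup>2 * exp x"
    by (simp add: card_permutations[OF refl A] power2_eq_square)
  finally show ?thesis .
qed

text \<open>A second-order Taylor bound for the concave power at 1. The difference \<open>h\<close>
  of the two sides vanishes at 0 and has derivative \<open>\<alpha> / 2 * k\<close>;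
  \<open>k\<close> also vanishes at 0 and is nondecreasing by AM-GM.\<close>

lemma binary_powr_mean_le:
  fixes \<alpha> \<delta> :: real
  assumes \<alpha>: "0 < \<alpha>" "\<alpha> < 1" and \<delta>: "0 \<le> \<delta>" "\<delta> < 1"
  shows "((1 + \<delta>) powr \<alpha> + (1 - \<delta>) powr \<alpha>) / 2 \<le> 1 - \<alpha> * (1 - \<alpha>) * \<delta>\<^sup>2 / 2"
proof -
  define k where "k x = (1 - x) powr (\<alpha> - 1) - (1 + x) powr (\<alpha> - 1) - 2 * (1 - \<alpha>) * x" for x :: real
  define h where "h x = 1 - \<alpha> * (1 - \<alpha>) * x\<^sup>2 / 2 - ((1 + x) powr \<alpha> + (1 - x) powr \<alpha>) / 2" for x :: real
  have k: "0 \<le> k x" if "0 \<le> x" "x < 1" for x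
  proof -
    have "k 0 \<le> k x"
    proof (rule DERIV_nonneg_imp_nondecreasing[OF that(1)])
      fix y assume y: "0 \<le> y" "y \<le> x"
      hence pos: "0 < 1 - y" "0 < 1 + y" using that by auto
      let ?D = "(1 - \<alpha>) * ((1 - y) powr (\<alpha> - 2) + (1 + y) powr (\<alpha> - 2) - 2)"
      have "(k has_real_derivative ?D) (at y)"
        unfolding k_def using pos by (auto intro!: derivative_eq_intros simp: algebra_simps)
      moreover have "0 \<le> ?D"
      proof (intro mult_nonneg_nonneg)
        \<comment> \<open>\<open>u\<close> and \<open>v\<close> are the square roots of the two
          powers. Their product is a negative power of \<open>1 - y^2\<close>, a number in (0, 1],
          so it is at least 1.\<close>
        define u v where "u = (1 - y) powr ((\<alpha> - 2) / 2)" and "v = (1 + y) powr ((\<alpha> - 2) / 2)"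
        have "u\<^sup>2 = (1 - y) powr (\<alpha> - 2)" "v\<^sup>2 = (1 + y) powr (\<alpha> - 2)"
          by (simp_all add: u_def v_def power2_eq_square flip: powr_add)
        moreover have "1 \<le> u * v"
        proof -
          have "u * v = (1 - y\<^sup>2) powr ((\<alpha> - 2) / 2)"
            using pos by (simp add: u_def v_def power2_eq_square algebra_simps flip: powr_mult)
          moreover have "0 < 1 - y\<^sup>2" using pos mult_pos_pos[OF pos] by (simp add: power2_eq_square algebra_simps)
          moreover have "1 - y\<^sup>2 \<le> 1" by simp
          ultimately show ?thesis using \<alpha> powr_mono2'[of "(\<alpha> - 2) / 2" "1 - y\<^sup>2" 1] by simp
        qed
        moreover have "2 * (u * v) \<le> u\<^sup>2 + v\<^sup>2" using sum_squares_bound[of u v] by (simp add: mult_ac)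
        ultimately show "0 \<le> (1 - y) powr (\<alpha> - 2) + (1 + y) powr (\<alpha> - 2) - 2" by linarith
      qed (use \<alpha> in simp)
      ultimately show "\<exists>D. (k has_real_derivative D) (at y) \<and> 0 \<le> D" by blast
    qed
    thus ?thesis by (simp add: k_def)
  qed
  have "h 0 \<le> h \<delta>"
  proof (rule DERIV_nonneg_imp_nondecreasing[OF \<delta>(1)])
    fix y assume y: "0 \<le> y" "y \<le> \<delta>"
    hence pos: "0 < 1 - y" "0 < 1 + y" using \<delta> by auto
    have "(h has_real_derivative \<alpha> / 2 * k y) (at y)"
      unfolding h_def k_def using pos by (auto intro!: derivative_eq_intros simp: field_simps)
    moreover have "0 \<le> \<alpha> / 2 * k y" using k[of y] y \<delta> \<alpha> by simp
    ultimately show "\<exists>D. (h has_real_derivative D) (at y) \<and> 0 \<le> D" by blast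
  qed
  thus ?thesis by (simp add: h_def)
qed

section \<open>States built from reflections on pairs of coordinates\<close>

text \<open>\<open>f\<close> pairs up coordinates; on the pair \<open>a\<close>, \<open>f a\<close> the basis is the reflection with entries
  \<open>c a\<close>, \<open>s a\<close>, \<open>s a\<close>, \<open>- c a\<close>. Being real, symmetric and involutive, it is its own adjoint
  and inverse.\<close>

definition two_level :: "nat \<Rightarrow> (nat \<Rightarrow> nat) \<Rightarrow> (nat \<Rightarrow> real) \<Rightarrow> (nat \<Rightarrow> real) \<Rightarrow> bool" where
  "two_level d f c s \<longleftrightarrow> (\<forall>a<d. f a < d \<and> f (f a) = a \<and> (c a)\<^sup>2 + (s a)\<^sup>2 = 1 \<and> s (f a) = s a \<and>
     (if f a = a then s a = 0 else c (f a) = - c a))"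

definition two_level_basis :: "(nat \<Rightarrow> nat) \<Rightarrow> (nat \<Rightarrow> real) \<Rightarrow> (nat \<Rightarrow> real) \<Rightarrow> nat \<Rightarrow> nat \<Rightarrow> real" where
  "two_level_basis f c s a b = (if b = a then c a else 0) + (if b = f a then s a else 0)"

text \<open>The matrix with eigenbasis \<open>two_level_basis\<close> and eigenvalues
  \<open>l\<close>. At a fixed point of \<open>f\<close> both conditions hold, and
  \<open>s a = 0\<close> removes the surplus terms.\<close>

definition two_level_kernel :: "(nat \<Rightarrow> nat) \<Rightarrow> (nat \<Rightarrow> real) \<Rightarrow> (nat \<Rightarrow> real) \<Rightarrow> (nat \<Rightarrow> real)
    \<Rightarrow> nat \<Rightarrow> nat \<Rightarrow> real" where
  "two_level_kernel f c s l a b = (if b = a then (c a)\<^sup>2 * l a + (s a)\<^sup>2 * l (f a) else 0)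
     + (if b = f a then c a * s a * (l a - l (f a)) else 0)"

lemma two_level_spectral:
  assumes "two_level d f c s"
  defines "U \<equiv> kernel_mat d (two_level_basis f c s)"
  shows "U * mat_diag d (\<lambda>i. complex_of_real (l i)) * mat_adjoint U
    = kernel_mat d (two_level_kernel f c s l)"
proof (rule eq_matI)
  have Uc: "U \<in> carrier_mat d d" by (simp add: U_def kernel_mat_def)
  fix a b assume "a < dim_row (kernel_mat d (two_level_kernel f c s l))"
    "b < dim_col (kernel_mat d (two_level_kernel f c s l))"
  hence ab: "a < d" "b < d" by (auto simp: kernel_mat_def)
  note t = assms(1)[unfolded two_level_def, rule_format]
  let ?u = "two_level_basis f c s"
  have "(\<Sum>k<d. ?u a k * l k * ?u b k)
    = (\<Sum>k<d. if k = a then c a * l k * ?u b k else 0) + (\<Sum>k<d. if k = f a then s a * l k * ?u b k else 0)"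
    unfolding sum.distrib[symmetric]
    by (intro sum.cong refl) (auto simp: two_level_basis_def[of f c s a] distrib_right)
  also have "\<dots> = c a * l a * ?u b a + s a * l (f a) * ?u b (f a)"
    using ab t[of a] by simp
  also have "\<dots> = two_level_kernel f c s l a b"
    using t[OF ab(1)] t[OF ab(2)]
    by (auto simp: two_level_kernel_def two_level_basis_def power2_eq_square algebra_simps
        split: if_splits)
  finally have "(\<Sum>k<d. ?u a k * l k * ?u b k) = two_level_kernel f c s l a b" .
  moreover have "(U * mat_diag d (\<lambda>i. complex_of_real (l i)) * mat_adjoint U) $$ (a, b)
    = complex_of_real (\<Sum>k<d. ?u a k * l k * ?u b k)"
    using ab unfolding spectral_mat_index[OF Uc ab] by (simp add: U_def kernel_mat_def)
  ultimately show "(U * mat_diag d (\<lambda>i. complex_of_real (l i)) * mat_adjoint U) $$ (a, b)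
    = kernel_mat d (two_level_kernel f c s l) $$ (a, b)"
    using ab by (simp add: kernel_mat_def)
qed (simp_all add: U_def kernel_mat_def mat_adjoint_def)

lemma two_level_unitary:
  assumes "two_level d f c s"
  shows "unitary_mat d (kernel_mat d (two_level_basis f c s))"
proof -
  let ?U = "kernel_mat d (two_level_basis f c s)"
  have Uc: "?U \<in> carrier_mat d d" by (simp add: kernel_mat_def)
  \<comment> \<open>The spectral formula with all eigenvalues equal to 1 computes this
    product.\<close>
  have "?U * mat_adjoint ?U = kernel_mat d (two_level_kernel f c s (\<lambda>_. 1))"
    using two_level_spectral[OF assms, of "\<lambda>_. 1"] Uc by (simp add: right_mult_one_mat[of _ d d])
  also have "\<dots> = 1\<^sub>m d"
    using assms by (intro eq_matI) (auto simp: kernel_mat_def two_level_kernel_def two_level_def)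
  finally show ?thesis using Uc by (simp add: unitary_mat_def)
qed

lemma two_level_density_op:
  assumes "two_level d f c s" "\<And>i. 0 \<le> l i" "(\<Sum>i<d. l i) = 1"
  shows "density_op d (kernel_mat d (two_level_kernel f c s l))"
  using spectral_density_op[OF two_level_unitary[OF assms(1)] assms(2,3)]
    two_level_spectral[OF assms(1), of l] by simp

lemma two_level_tsallis:
  assumes t: "two_level d f c s" and "\<And>i. 0 \<le> l i" "\<And>i. 0 \<le> q i"
  shows "tsallis_rel_ent \<alpha> (kernel_mat d (two_level_kernel f c s l))
      (mat_diag d (\<lambda>i. complex_of_real (q i)))
    = (1 - (\<Sum>a<d. ((c a)\<^sup>2 * l a powr \<alpha> + (s a)\<^sup>2 * l (f a) powr \<alpha>) * q a powr (1 - \<alpha>))) / (1 - \<alpha>)"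
proof -
  let ?U = "kernel_mat d (two_level_basis f c s)"
  have "(\<Sum>k<d. (cmod (?U $$ (a, k)))\<^sup>2 * l k powr \<alpha>) = (c a)\<^sup>2 * l a powr \<alpha> + (s a)\<^sup>2 * l (f a) powr \<alpha>"
    if a: "a < d" for a
  proof -
    note ta = t[unfolded two_level_def, rule_format, OF a]
    have "(\<Sum>k<d. (cmod (?U $$ (a, k)))\<^sup>2 * l k powr \<alpha>)
      = (\<Sum>k<d. (if k = a then (c a)\<^sup>2 * l k powr \<alpha> else 0) + (if k = f a then (s a)\<^sup>2 * l k powr \<alpha> else 0))"
      using a ta by (intro sum.cong) (auto simp: kernel_mat_def two_level_basis_def)
    also have "\<dots> = (c a)\<^sup>2 * l a powr \<alpha> + (s a)\<^sup>2 * l (f a) powr \<alpha>"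
      using a ta by (simp add: sum.distrib)
    finally show ?thesis .
  qed
  thus ?thesis
    using tsallis_spectral_diag[OF two_level_unitary[OF t] assms(2,3) two_level_spectral[OF t, symmetric]]
    by simp
qed

section \<open>The two lower bounds\<close>

lemma mat_diag_kernel_mat:
  "mat_diag d (\<lambda>i. complex_of_real (q i)) = kernel_mat d (\<lambda>i j. if i = j then q i else 0)"
  by (rule eq_matI) (auto simp: mat_diag_def kernel_mat_def)

text \<open>When every coordinate is fixed the basis is the identity, which makes diagonal states an
  instance of the two-level calculus.\<close>

lemma two_level_trivial: "two_level d (\<lambda>a. a) (\<lambda>_. 1) (\<lambda>_. 0)"
  by (simp add: two_level_def)

lemma two_level_kernel_trivial:
  "kernel_mat d (two_level_kernel (\<lambda>a. a) (\<lambda>_. 1) (\<lambda>_. 0) q) = mat_diag d (\<lambda>i. complex_of_real (q i))"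
  unfolding mat_diag_kernel_mat by (rule eq_matI) (auto simp: kernel_mat_def two_level_kernel_def)

lemma mat_diag_density_op:
  assumes "\<And>i. 0 \<le> q i" "(\<Sum>i<d. q i) = 1"
  shows "density_op d (mat_diag d (\<lambda>i. complex_of_real (q i)))"
  using two_level_density_op[OF two_level_trivial assms] by (simp add: two_level_kernel_trivial)

lemma tsallis_self:
  assumes "0 < \<alpha>" "\<alpha> < 1" "\<And>i. 0 \<le> q i" "(\<Sum>i<d. q i) = 1"
  shows "tsallis_rel_ent \<alpha> (mat_diag d (\<lambda>i. complex_of_real (q i))) (mat_diag d (\<lambda>i. complex_of_real (q i))) = 0"
proof -
  \<comment> \<open>Zero eigenvalues obey this too, since \<open>0 powr a = 0\<close>.\<close>
  have "q i powr \<alpha> * q i powr (1 - \<alpha>) = q i" for i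
    using assms(1-3) by (cases "q i = 0") (simp_all add: less_le flip: powr_add)
  thus ?thesis
    using two_level_tsallis[OF two_level_trivial assms(3,3), of \<alpha> d] assms(4)
    by (simp add: two_level_kernel_trivial)
qed

lemma det_mat_diag_nonzero:
  assumes "\<And>i. i < d \<Longrightarrow> q i \<noteq> 0"
  shows "det (mat_diag d q :: complex mat) \<noteq> 0"
proof -
  have "mat_diag d q * mat_diag d (\<lambda>i. 1 / q i) = 1\<^sub>m d"
    using assms unfolding mat_diag_diag by (intro eq_matI) (auto simp: mat_diag_def)
  hence "det (mat_diag d q) * det (mat_diag d (\<lambda>i. 1 / q i)) = 1"
    by (metis det_mult det_one mat_diag_dim)
  thus ?thesis by auto
qed

lemma mrank_mat_diag_full:
  assumes "\<And>i. i < d \<Longrightarrow> q i \<noteq> 0"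
  shows "mrank (mat_diag d q) = d"
  using vec_space.det_rank_iff[OF mat_diag_dim, of d q] det_mat_diag_nonzero[OF assms]
  by (simp add: mrank_def mat_diag_def)

text \<open>Adding the rank-one matrix \<open>?B\<close> makes the matrix invertible, so by
  subadditivity at most one dimension is missing. One is missing, because the last basis vector lies
  in the kernel.\<close>

lemma mrank_mat_diag_but_last:
  assumes "\<And>i. i < r \<Longrightarrow> q i \<noteq> 0" "q r = 0"
  shows "mrank (mat_diag (Suc r) q) = r"
proof -
  let ?A = "mat_diag (Suc r) q"
  let ?B = "mat_diag (Suc r) (\<lambda>i. if i = r then 1 else 0 :: complex)"
  have A: "?A \<in> carrier_mat (Suc r) (Suc r)" and B: "?B \<in> carrier_mat (Suc r) (Suc r)" by simp_all
  have "vec_space.rank (Suc r) (?A + ?B) = Suc r"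
  proof -
    have "?A + ?B = mat_diag (Suc r) (\<lambda>i. if i = r then 1 else q i)"
      using assms(2) by (intro eq_matI) (auto simp: mat_diag_def)
    thus ?thesis using mrank_mat_diag_full[of "Suc r" "\<lambda>i. if i = r then 1 else q i"] assms(1)
      by (simp add: mrank_def mat_diag_def)
  qed
  moreover have "vec_space.rank (Suc r) (?A + ?B) \<le> vec_space.rank (Suc r) ?A + vec_space.rank (Suc r) ?B"
    by (rule vec_space.rank_subadditive[OF A B])
  moreover have "vec_space.rank (Suc r) ?B \<le> 1"
    by (rule vec_space.rank_le_1_product_entries[OF B, of "\<lambda>i. if i = r then 1 else 0" "\<lambda>i. if i = r then 1 else 0"])
      (auto simp: mat_diag_def)
  moreover have "vec_space.rank (Suc r) ?A \<le> Suc r" by (rule vec_space.rank_le_nc[OF A])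
  moreover have "vec_space.rank (Suc r) ?A \<noteq> Suc r"
  proof -
    have "?A *\<^sub>v unit_vec (Suc r) r = 0\<^sub>v (Suc r)"
      using assms(2) by (intro eq_vecI) (auto simp: mat_diag_def scalar_prod_def unit_vec_def if_distrib cong: if_cong)
    moreover have "unit_vec (Suc r) r \<noteq> (0\<^sub>v (Suc r) :: complex vec)"
      by (metis index_unit_vec(1) index_zero_vec(1) lessI zero_neq_one)
    ultimately have "det ?A = 0" using det_0_iff_vec_prod_zero[OF A] unit_vec_carrier by blast
    thus ?thesis using vec_space.det_rank_iff[OF A] by simp
  qed
  ultimately show ?thesis by (simp add: mrank_def mat_diag_def)
qed

section \<open>Rotated pure states and the inverse-square bound\<close>

definition rotation_fun :: "nat \<Rightarrow> real \<Rightarrow> nat \<Rightarrow> real" where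
  "rotation_fun r C a = (if a = 0 then sqrt C else if a = r then sqrt (1 - C) else 0)"

definition rotation_state :: "nat \<Rightarrow> real \<Rightarrow> complex mat" where
  "rotation_state r C = kernel_mat (Suc r) (\<lambda>a b. rotation_fun r C a * rotation_fun r C b)"

lemma sum_rotation_fun:
  assumes "r \<ge> 1" "0 \<le> C" "C \<le> 1" "0 \<le> C'" "C' \<le> 1"
  shows "(\<Sum>a<Suc r. rotation_fun r C a * rotation_fun r C' a) = sqrt (C * C') + sqrt ((1 - C) * (1 - C'))"
proof -
  have "(\<Sum>a<Suc r. rotation_fun r C a * rotation_fun r C' a)
    = (\<Sum>a<Suc r. (if a = 0 then sqrt (C * C') else 0) + (if a = r then sqrt ((1 - C) * (1 - C')) else 0))"
    using assms by (intro sum.cong) (auto simp: rotation_fun_def real_sqrt_mult)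
  thus ?thesis by (simp add: sum.distrib)
qed

text \<open>The reflection mixing coordinates 0 and \<open>r\<close> has the amplitudes as its
  column 0, and index 0 carries the only nonzero eigenvalue, 1. A projection equals its positive
  powers, and \<open>q r = 0\<close> leaves only the weight \<open>C\<close> on coordinate 0, so the
  divergence is affine in \<open>C\<close>.\<close>

lemma rotation_state_props:
  assumes r: "r \<ge> 1" and C: "0 \<le> C" "C \<le> 1" and q: "\<And>i. 0 \<le> q i" "q r = 0" and \<alpha>: "0 < \<alpha>" "\<alpha> < 1"
  shows "density_op (Suc r) (rotation_state r C)" "mrank (rotation_state r C) \<le> r"
    "tsallis_rel_ent \<alpha> (rotation_state r C) (mat_diag (Suc r) (\<lambda>i. complex_of_real (q i)))
      = (1 - C * q 0 powr (1 - \<alpha>)) / (1 - \<alpha>)"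
proof -
  define f where "f a = (if a = 0 then r else if a = r then 0 else a)" for a
  define c where "c a = (if a = 0 then sqrt C else if a = r then - sqrt C else 1)" for a
  define s where "s a = (if a = 0 \<or> a = r then sqrt (1 - C) else 0)" for a
  define l where "l a = (if a = 0 then 1 else 0 :: real)" for a :: nat
  have t: "two_level (Suc r) f c s"
    using r C by (auto simp: two_level_def f_def c_def s_def)
  have eq: "rotation_state r C = kernel_mat (Suc r) (two_level_kernel f c s l)"
    unfolding rotation_state_def kernel_mat_def using r C
    by (intro eq_matI) (auto simp: two_level_kernel_def rotation_fun_def f_def c_def s_def l_def
        simp flip: of_real_mult)
  have l: "\<And>i. 0 \<le> l i" by (simp add: l_def)
  show "density_op (Suc r) (rotation_state r C)"
    unfolding eq by (rule two_level_density_op[OF t l]) (simp add: l_def)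
  have "vec_space.rank (Suc r) (rotation_state r C) \<le> 1"
    by (rule vec_space.rank_le_1_product_entries[of _ _ "Suc r" "\<lambda>a. complex_of_real (rotation_fun r C a)"
          "\<lambda>a. complex_of_real (rotation_fun r C a)"])
      (auto simp: rotation_state_def kernel_mat_def)
  thus "mrank (rotation_state r C) \<le> r" using r by (simp add: mrank_def rotation_state_def kernel_mat_def)
  have "(\<Sum>a<Suc r. ((c a)\<^sup>2 * l a powr \<alpha> + (s a)\<^sup>2 * l (f a) powr \<alpha>) * q a powr (1 - \<alpha>))
    = (\<Sum>a<Suc r. if a = 0 then C * q 0 powr (1 - \<alpha>) else 0)"
    using r C q \<alpha> by (intro sum.cong) (auto simp: c_def l_def s_def f_def)
  thus "tsallis_rel_ent \<alpha> (rotation_state r C) (mat_diag (Suc r) (\<lambda>i. complex_of_real (q i)))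
      = (1 - C * q 0 powr (1 - \<alpha>)) / (1 - \<alpha>)"
    unfolding eq two_level_tsallis[OF t l q(1)] by simp
qed

lemma success_prob_rotation_state:
  assumes "povm (Suc r ^ n) K M"
  shows "success_prob n K M x (rotation_state r C) y \<epsilon>
    = real_form (Suc r ^ n) (outcome_kernel M {k. k < K \<and> \<bar>x k - y\<bar> \<le> \<epsilon>})
        (tensor_fun (Suc r) (rotation_fun r C) n)"
  unfolding rotation_state_def success_prob_kernel_mat[OF assms] tensor_kernel_product real_form_def
  by (simp add: mult_ac)

lemma inverse_square_bound:
  fixes \<alpha> \<epsilon> :: real
  assumes \<alpha>: "0 < \<alpha>" "\<alpha> < 1" and \<epsilon>: "0 < \<epsilon>" "\<epsilon> < \<alpha> * (1 - \<alpha>) / 4" and r: "r \<ge> (1::nat)"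
  shows "\<exists>\<sigma>. density_op (Suc r) \<sigma> \<and> mrank \<sigma> = r \<and>
      (\<forall>n K M x. povm (Suc r ^ n) K M \<and>
         (\<forall>\<rho>. density_op (Suc r) \<rho> \<and> mrank \<rho> \<le> r \<longrightarrow>
              success_prob n K M x \<rho> (tsallis_rel_ent \<alpha> \<rho> \<sigma>) \<epsilon> \<ge> 2 / 3)
         \<longrightarrow> real n \<ge> 1 / (1152 * \<epsilon>\<^sup>2))"
proof -
  \<comment> \<open>The rank has to be exactly \<open>r\<close> with \<open>q 0 \<ge> 1 / 2\<close>:
    besides \<open>q 0\<close> there are \<open>r - 1\<close> weights \<open>1 / (2 * r)\<close>,
    and coordinate \<open>r\<close> is missed.\<close>
  define q where "q i = (if i = 0 then (r + 1) / (2 * r) else if i < r then 1 / (2 * r) else 0)" for i :: nat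
  define \<sigma> where "\<sigma> = mat_diag (Suc r) (\<lambda>i. complex_of_real (q i))"
  have q: "0 \<le> q i" "q r = 0" for i using r by (auto simp: q_def)
  have "{..<Suc r} = insert 0 (insert r {1..<r})" using r by auto
  hence "(\<Sum>i<Suc r. q i) = q 0 + (\<Sum>i=1..<r. q i)" using r q by simp
  also have "(\<Sum>i=1..<r. q i) = (\<Sum>i=1..<r. 1 / (2 * r))" by (intro sum.cong) (auto simp: q_def)
  also have "q 0 + \<dots> = 1" using r by (simp add: q_def field_simps of_nat_diff)
  finally have sum_q: "(\<Sum>i<Suc r. q i) = 1" .
  have "mrank \<sigma> = r" unfolding \<sigma>_def
    using q(2) by (intro mrank_mat_diag_but_last) (auto simp: q_def)
  moreover have "density_op (Suc r) \<sigma>" unfolding \<sigma>_def by (rule mat_diag_density_op[OF q(1) sum_q])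
  moreover have "real n \<ge> 1 / (1152 * \<epsilon>\<^sup>2)"
    if M: "povm (Suc r ^ n) K M" and succ: "\<And>\<rho>. density_op (Suc r) \<rho> \<Longrightarrow> mrank \<rho> \<le> r \<Longrightarrow>
              success_prob n K M x \<rho> (tsallis_rel_ent \<alpha> \<rho> \<sigma>) \<epsilon> \<ge> 2 / 3" for n K M x
  proof -
    have \<epsilon>16: "\<epsilon> < 1 / 16"
    proof -
      have "0 \<le> (\<alpha> - 1 / 2)\<^sup>2" by simp
      hence "\<alpha> * (1 - \<alpha>) \<le> 1 / 4" by (simp add: power2_eq_square algebra_simps)
      thus ?thesis using \<epsilon> by linarith
    qed
    \<comment> \<open>A shift of the weight by \<open>4 * \<epsilon>\<close> moves the divergence by
      at least \<open>2 * \<epsilon> / (1 - \<alpha>)\<close>, because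
      \<open>q 0 powr (1 - \<alpha>) \<ge> 1 / 2\<close>. The bound
      \<open>\<epsilon> < 1 / 16\<close> keeps \<open>C\<close> below 1.\<close>
    define C :: real where "C = 1 / 2 + 4 * \<epsilon>"
    have C: "0 \<le> C" "C \<le> 1" using \<epsilon> \<epsilon>16 by (auto simp: C_def)
    have half: "0 \<le> (1 / 2 :: real)" "(1 / 2 :: real) \<le> 1" by simp_all
    define y where "y c = (1 - c * q 0 powr (1 - \<alpha>)) / (1 - \<alpha>)" for c
    define S where "S c = {k. k < K \<and> \<bar>x k - y c\<bar> \<le> \<epsilon>}" for c
    define v where "v c = tensor_fun (Suc r) (rotation_fun r c) n" for c
    have s: "2 / 3 \<le> real_form (Suc r ^ n) (outcome_kernel M (S c)) (v c)" if "0 \<le> c" "c \<le> 1" for c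
      using succ[OF rotation_state_props(1)[where q = q, OF r that q \<alpha>] rotation_state_props(2)[where q = q, OF r that q \<alpha>]]
      unfolding \<sigma>_def rotation_state_props(3)[where q = q, OF r that q \<alpha>] success_prob_rotation_state[OF M]
        S_def v_def y_def .
    have gap: "y (1 / 2) - y C > 2 * \<epsilon>"
    proof -
      have "1 / 2 \<le> q 0" "q 0 \<le> 1" using r by (auto simp: q_def field_simps)
      hence "q 0 powr 1 \<le> q 0 powr (1 - \<alpha>)" using \<alpha> by (intro powr_mono') auto
      hence q0: "1 / 2 \<le> q 0 powr (1 - \<alpha>)" using \<open>1 / 2 \<le> q 0\<close> by simp
      have "2 * \<epsilon> < 2 * \<epsilon> / (1 - \<alpha>)" using \<alpha> \<epsilon> by (simp add: field_simps)
      also have "\<dots> \<le> 4 * \<epsilon> * q 0 powr (1 - \<alpha>) / (1 - \<alpha>)"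
        using \<alpha> q0 \<epsilon> by (intro divide_right_mono) auto
      also have "\<dots> = y (1 / 2) - y C"
        unfolding y_def C_def diff_divide_distrib[symmetric] by (simp add: algebra_simps)
      finally show ?thesis .
    qed
    hence disj: "S C \<inter> S (1 / 2) = {}" unfolding S_def by auto
    \<comment> \<open>\<open>F\<close> is the overlap of the two single-copy vectors; the n-fold
      ones have overlap \<open>F ^ n\<close> and squared distance
      \<open>2 - 2 * F ^ n\<close>.\<close>
    define F where "F = (sqrt (1 + 8 * \<epsilon>) + sqrt (1 - 8 * \<epsilon>)) / 2"
    have inner: "(\<Sum>i<Suc r ^ n. v c i * v c' i) = (sqrt (c * c') + sqrt ((1 - c) * (1 - c'))) ^ n"
      if "0 \<le> c" "c \<le> 1" "0 \<le> c'" "c' \<le> 1" for c c'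
      unfolding v_def tensor_fun_inner sum_rotation_fun[OF r that] ..
    have unit: "(\<Sum>i<Suc r ^ n. (v c i)\<^sup>2) = 1" if "0 \<le> c" "c \<le> 1" for c
      using inner[OF that that] that by (simp add: power2_eq_square)
    have cross: "(\<Sum>i<Suc r ^ n. v C i * v (1 / 2) i) = F ^ n"
    proof -
      have "C * (1 / 2) = (1 + 8 * \<epsilon>) / 2\<^sup>2" "(1 - C) * (1 - 1 / 2) = (1 - 8 * \<epsilon>) / 2\<^sup>2"
        by (simp_all add: C_def field_simps)
      hence "sqrt (C * (1 / 2)) + sqrt ((1 - C) * (1 - 1 / 2)) = F"
        by (simp only: real_sqrt_divide F_def) simp
      thus ?thesis using inner[OF C half] by simp
    qed
    have "S C \<subseteq> {..<K}" "S (1 / 2) \<subseteq> {..<K}" by (auto simp: S_def)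
    from pure_state_discrimination[OF M this disj unit[OF half] s[OF C] s[OF half]]
    have "1 / 18 \<le> (\<Sum>i<Suc r ^ n. (v C i - v (1 / 2) i)\<^sup>2)" .
    also have "\<dots> = (\<Sum>i<Suc r ^ n. (v C i)\<^sup>2) + (\<Sum>i<Suc r ^ n. (v (1 / 2) i)\<^sup>2)
        - 2 * (\<Sum>i<Suc r ^ n. v C i * v (1 / 2) i)"
      unfolding sum_distrib_left sum.distrib[symmetric] sum_subtractf[symmetric]
      by (intro sum.cong refl) (simp add: power2_eq_square algebra_simps)
    also have "\<dots> = 2 - 2 * F ^ n" by (simp only: unit[OF C] unit[OF half] cross)
    finally have 1: "1 / 18 \<le> 2 - 2 * F ^ n" .
    \<comment> \<open>As \<open>F\<close> and \<open>w\<close> lie in [0, 1], \<open>F \<ge> F^2 =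
      (1 + w) / 2 \<ge> (1 + w^2) / 2 = 1 - 32 * \<epsilon>^2\<close>.\<close>
    have F: "1 - 32 * \<epsilon>\<^sup>2 \<le> F" "0 \<le> F"
    proof -
      define w where "w = sqrt ((1 + 8 * \<epsilon>) * (1 - 8 * \<epsilon>))"
      have pos: "0 \<le> 1 + 8 * \<epsilon>" "0 \<le> 1 - 8 * \<epsilon>" using \<epsilon> \<epsilon>16 by auto
      hence w: "w\<^sup>2 = 1 - 64 * \<epsilon>\<^sup>2" "0 \<le> w"
        by (simp_all add: w_def) (simp add: power2_eq_square algebra_simps)
      have F2: "F\<^sup>2 = (1 + w) / 2"
        using pos by (simp add: F_def w_def power_divide power2_sum real_sqrt_mult)
      have "w\<^sup>2 \<le> 1\<^sup>2" using w by simp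
      hence w1: "w \<le> 1" by (rule power2_le_imp_le) simp
      show F0: "0 \<le> F" using pos by (simp add: F_def)
      have "F\<^sup>2 \<le> 1\<^sup>2" using F2 w1 by simp
      hence "F \<le> 1" by (rule power2_le_imp_le) simp
      hence "F\<^sup>2 \<le> F" using F0 by (simp add: power2_eq_square mult_left_le)
      moreover have "w\<^sup>2 \<le> w" using w(2) w1 by (simp add: power2_eq_square mult_left_le)
      ultimately show "1 - 32 * \<epsilon>\<^sup>2 \<le> F" using F2 w by simp
    qed
    \<comment> \<open>Bernoulli turns the distance bound into
      \<open>1 / 18 \<le> 64 * n * \<epsilon>^2\<close>, and \<open>18 * 64 = 1152\<close>.\<close>
    have "1 + real n * (F - 1) \<le> F ^ n" using Bernoulli_inequality[of "F - 1" n] F(2) by simp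
    moreover have "real n * (- 32 * \<epsilon>\<^sup>2) \<le> real n * (F - 1)" using F(1) by (intro mult_left_mono) auto
    ultimately have "1 \<le> 1152 * (real n * \<epsilon>\<^sup>2)" using 1 by simp
    thus ?thesis using \<epsilon> by (simp add: field_simps)
  qed
  ultimately show ?thesis by blast
qed

section \<open>Random matching states and the rank bound\<close>

text \<open>The perfect matching \<open>i \<leftrightarrow> m + \<pi> i\<close> perturbs the maximally mixed state; for odd \<open>r\<close> the
  last coordinate is left alone.\<close>

definition matching_kernel :: "nat \<Rightarrow> nat \<Rightarrow> real \<Rightarrow> (nat \<Rightarrow> nat) \<Rightarrow> nat \<Rightarrow> nat \<Rightarrow> real" where
  "matching_kernel r m \<delta> \<pi> a b = ((if a = b then 1 else 0)
     + \<delta> * ((if a < m \<and> b = m + \<pi> a then 1 else 0) + (if b < m \<and> a = m + \<pi> b then 1 else 0))) / r"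

text \<open>On a matched pair the state is a block with diagonal \<open>1 / r\<close> and
  off-diagonal \<open>\<delta> / r\<close>. Its eigenvectors are \<open>(1, 1) / sqrt 2\<close> and
  \<open>(1, -1) / sqrt 2\<close>, its eigenvalues \<open>(1 + \<delta>) / r\<close> and
  \<open>(1 - \<delta>) / r\<close>.\<close>

lemma matching_state_props:
  assumes \<pi>: "\<pi> permutes {..<m}" and m: "2 * m \<le> r" "1 \<le> r" and \<delta>: "0 \<le> \<delta>" "\<delta> < 1"
    and \<alpha>: "0 < \<alpha>" "\<alpha> < 1"
  defines "\<rho> \<equiv> kernel_mat r (matching_kernel r m \<delta> \<pi>)"
  shows "density_op r \<rho>"
    "tsallis_rel_ent \<alpha> \<rho> (mat_diag r (\<lambda>_. complex_of_real (1 / real r)))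
      = real (2 * m) / real r * (1 - ((1 + \<delta>) powr \<alpha> + (1 - \<delta>) powr \<alpha>) / 2) / (1 - \<alpha>)"
proof -
  define f where "f a = (if a < m then m + \<pi> a else if a < 2 * m then inv_into UNIV \<pi> (a - m) else a)" for a
  define g where "g a = (if a < m then 1 else if a < 2 * m then - 1 else 0 :: real)" for a
  define c where "c a = (if a < m then 1 / sqrt 2 else if a < 2 * m then - (1 / sqrt 2) else 1)" for a
  define s where "s a = (if a < 2 * m then 1 / sqrt 2 else 0)" for a
  define l where "l a = (1 + \<delta> * g a) / r" for a
  have p: "\<pi> a < m" if "a < m" for a using permutes_in_image[OF \<pi>] that by simp
  have ip: "inv_into UNIV \<pi> a < m" if "a < m" for a using permutes_in_image[OF permutes_inv[OF \<pi>]] that by simp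
  have inv: "inv_into UNIV \<pi> (\<pi> a) = a" "\<pi> (inv_into UNIV \<pi> a) = a" for a using permutes_inverses[OF \<pi>] by auto
  \<comment> \<open>Naming an upper index through its partner \<open>a'\<close> keeps the inverse
    permutation out of the later case analyses.\<close>
  have trichotomy: "a < m \<or> (\<exists>a'<m. a = m + \<pi> a') \<or> 2 * m \<le> a" for a
  proof -
    have "a = m + \<pi> (inv_into UNIV \<pi> (a - m)) \<and> inv_into UNIV \<pi> (a - m) < m" if "\<not> a < m" "\<not> 2 * m \<le> a"
      using that ip[of "a - m"] by (simp add: inv)
    thus ?thesis by blast
  qed
  have f: "f a = m + \<pi> a" "f (m + \<pi> a) = a" "g (m + \<pi> a) = - 1" "c (m + \<pi> a) = - (1 / sqrt 2)"
    "s (m + \<pi> a) = 1 / sqrt 2" if "a < m" for a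
    using that p[OF that] by (auto simp: f_def g_def c_def s_def inv)
  have f': "g a = 1" "c a = 1 / sqrt 2" "s a = 1 / sqrt 2" if "a < m" for a
    using that by (auto simp: g_def c_def s_def)
  have f'': "f a = a" "g a = 0" "c a = 1" "s a = 0" if "2 * m \<le> a" for a
    using that by (auto simp: f_def g_def c_def s_def)
  have sq: "(c a)\<^sup>2 = 1 / 2" "(s a)\<^sup>2 = 1 / 2" "c a * s a = 1 / 2"
      "(c (m + \<pi> a))\<^sup>2 = 1 / 2" "(s (m + \<pi> a))\<^sup>2 = 1 / 2" "c (m + \<pi> a) * s (m + \<pi> a) = - (1 / 2)"
    if "a < m" for a
    unfolding f[OF that] f'[OF that] by (simp_all add: power_divide)
  have t: "two_level r f c s" unfolding two_level_def
  proof (intro allI impI)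
    fix a assume "a < r"
    from trichotomy[of a] show "f a < r \<and> f (f a) = a \<and> (c a)\<^sup>2 + (s a)\<^sup>2 = 1 \<and> s (f a) = s a \<and>
     (if f a = a then s a = 0 else c (f a) = - c a)"
    proof (elim disjE exE conjE)
      assume "a < m" thus ?thesis using f[of a] f'[of a] p[of a] m by (auto simp: power_divide)
    next
      fix a' assume "a' < m" "a = m + \<pi> a'"
      thus ?thesis using f[of a'] f'[of a'] p[of a'] m by (auto simp: power_divide)
    next
      assume "2 * m \<le> a" thus ?thesis using f''[of a] \<open>a < r\<close> by simp
    qed
  qed
  have eq: "\<rho> = kernel_mat r (two_level_kernel f c s l)"
  proof -
    have "matching_kernel r m \<delta> \<pi> a b = two_level_kernel f c s l a b" for a b
      using trichotomy[of a]
    proof (elim disjE exE conjE)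
      assume "a < m" thus ?thesis using f(1-3)[of a] f'(1)[of a] p[of a] m
        by (auto simp: matching_kernel_def two_level_kernel_def l_def sq)
           (simp_all add: field_simps)
    next
      fix a' assume a: "a' < m" "a = m + \<pi> a'"
      have "b < m \<and> m + \<pi> a' = m + \<pi> b \<longleftrightarrow> b = a'" using a inv(1) by (metis add_left_cancel)
      thus ?thesis using a(1) f(1-3)[of a'] f'(1)[of a'] p[of a'] m
        unfolding a(2)
        by (auto simp: matching_kernel_def two_level_kernel_def l_def sq)
           (simp_all add: field_simps)
    next
      assume a: "2 * m \<le> a"
      have "\<not> (b < m \<and> a = m + \<pi> b)" using a p[of b] by auto
      thus ?thesis using a f''[of a] 
        by (auto simp: matching_kernel_def two_level_kernel_def l_def)
    qed
    hence "matching_kernel r m \<delta> \<pi> = two_level_kernel f c s l" by (intro ext)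
    thus ?thesis by (simp add: \<rho>_def)
  qed
  have l: "0 \<le> l i" for i using \<delta> by (auto simp: l_def g_def)
  \<comment> \<open>Only the multiplicities of the signs \<open>g\<close> matter here, so
    \<open>\<pi>\<close> drops out.\<close>
  have split: "(\<Sum>a<r. h (g a)) = real m * (h 1 + h (- 1)) + real (r - 2 * m) * h 0"
    for h :: "real \<Rightarrow> real"
  proof -
    have "(\<Sum>a<r. h (g a)) = (\<Sum>a<m. h (g a)) + (\<Sum>a=m..<2*m. h (g a)) + (\<Sum>a=2*m..<r. h (g a))"
      using m by (simp add: lessThan_atLeast0 sum.atLeastLessThan_concat)
    also have "(\<Sum>a<m. h (g a)) = (\<Sum>a<m. h 1)" by (intro sum.cong) (auto simp: g_def)
    also have "(\<Sum>a=m..<2*m. h (g a)) = (\<Sum>a=m..<2*m. h (- 1))" by (intro sum.cong) (auto simp: g_def)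
    also have "(\<Sum>a=2*m..<r. h (g a)) = (\<Sum>a=2*m..<r. h 0)" by (intro sum.cong) (auto simp: g_def)
    finally show ?thesis by (simp add: algebra_simps)
  qed
  have "(\<Sum>i<r. l i) = 1"
    using split[of "\<lambda>x. (1 + \<delta> * x) / r"] m by (simp add: l_def field_simps of_nat_diff)
  thus "density_op r \<rho>" unfolding eq by (rule two_level_density_op[OF t l])
  define G where "G = ((1 + \<delta>) powr \<alpha> + (1 - \<delta>) powr \<alpha>) / 2"
  \<comment> \<open>On a pair \<open>c^2 = s^2 = 1 / 2\<close>, so either diagonal entry averages
    the powers of both eigenvalues, which gives \<open>G\<close>.\<close>
  define h where "h x = (if x = 0 then 1 else G) / r" for x :: real
  have scale: "(y / r) powr \<alpha> * (1 / r) powr (1 - \<alpha>) = y powr \<alpha> / r" if "0 \<le> y" for y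
  proof -
    have "(y / r) powr \<alpha> * (1 / r) powr (1 - \<alpha>) = y powr \<alpha> * ((1 / r) powr \<alpha> * (1 / r) powr (1 - \<alpha>))"
      using that by (simp add: powr_divide)
    also have "(1 / r) powr \<alpha> * (1 / r) powr (1 - \<alpha>) = 1 / r"
      using m by (simp flip: powr_add)
    finally show ?thesis by simp
  qed
  have summand: "((c a)\<^sup>2 * l a powr \<alpha> + (s a)\<^sup>2 * l (f a) powr \<alpha>) * (1 / r) powr (1 - \<alpha>) = h (g a)" for a
  proof -
    have "((c a)\<^sup>2 * l a powr \<alpha> + (s a)\<^sup>2 * l (f a) powr \<alpha>) * (1 / r) powr (1 - \<alpha>)
      = (c a)\<^sup>2 * ((1 + \<delta> * g a) powr \<alpha> / r) + (s a)\<^sup>2 * ((1 + \<delta> * g (f a)) powr \<alpha> / r)"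
      using \<delta> scale[of "1 + \<delta> * g a"] scale[of "1 + \<delta> * g (f a)"]
      by (simp add: distrib_right mult.assoc l_def) (auto simp: g_def)
    also have "\<dots> = h (g a)" using trichotomy[of a]
    proof (elim disjE exE conjE)
      assume "a < m" thus ?thesis using f(1-3)[of a] f'(1)[of a]
        by (simp add: h_def G_def sq add_divide_distrib)
    next
      fix a' assume "a' < m" "a = m + \<pi> a'"
      thus ?thesis using f(1-3)[of a'] f'(1)[of a']
        by (simp add: h_def G_def sq add_divide_distrib)
    next
      assume "2 * m \<le> a" thus ?thesis using f''[of a] by (simp add: h_def)
    qed
    finally show ?thesis .
  qed
  have sum_h: "(\<Sum>a<r. h (g a)) = 1 - real (2 * m) / r * (1 - G)"
    unfolding split using m by (simp add: h_def field_simps of_nat_diff)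
  show "tsallis_rel_ent \<alpha> \<rho> (mat_diag r (\<lambda>_. complex_of_real (1 / real r)))
      = real (2 * m) / real r * (1 - ((1 + \<delta>) powr \<alpha> + (1 - \<delta>) powr \<alpha>) / 2) / (1 - \<alpha>)"
    unfolding eq G_def[symmetric]
    by (subst two_level_tsallis[OF t l, where q = "\<lambda>_. 1 / real r"]) (simp_all add: summand sum_h)
qed

lemma matching_kernel_trace:
  assumes "1 \<le> r"
  shows "(\<Sum>a<r. matching_kernel r m \<delta> \<pi> a a) = 1"
proof -
  have "matching_kernel r m \<delta> \<pi> a a = 1 / r" for a by (auto simp: matching_kernel_def)
  thus ?thesis using assms by simp
qed

text \<open>Matching entries are off-diagonal, so the terms linear in \<open>\<delta>\<close>
  vanish. Quadratic terms survive only at edges common to both matchings, each counted in both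
  orientations.\<close>

lemma matching_kernel_inner:
  assumes \<pi>: "\<pi> permutes {..<m}" and \<tau>: "\<tau> permutes {..<m}" and m: "2 * m \<le> r" "1 \<le> r"
  shows "r * (\<Sum>a<r. \<Sum>b<r. matching_kernel r m \<delta> \<pi> a b * matching_kernel r m \<delta> \<tau> a b)
    = 1 + 2 * \<delta>\<^sup>2 / r * card {a \<in> {..<m}. \<pi> a = \<tau> a}"
proof -
  define X where "X a b = (if a < m \<and> \<pi> a = \<tau> a \<and> b = m + \<pi> a then 1 else 0 :: real)" for a b
  have "matching_kernel r m \<delta> \<pi> a b * matching_kernel r m \<delta> \<tau> a b
      = ((if a = b then 1 else 0) + \<delta>\<^sup>2 * (X a b + X b a)) / (real r)\<^sup>2" for a b
    by (auto simp: matching_kernel_def X_def power2_eq_square)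
  hence "(\<Sum>a<r. \<Sum>b<r. matching_kernel r m \<delta> \<pi> a b * matching_kernel r m \<delta> \<tau> a b)
    = ((\<Sum>a<r. \<Sum>b<r. if a = b then 1 else 0)
       + \<delta>\<^sup>2 * ((\<Sum>a<r. \<Sum>b<r. X a b) + (\<Sum>a<r. \<Sum>b<r. X b a))) / (real r)\<^sup>2"
    by (simp only: sum_divide_distrib[symmetric] sum.distrib sum_distrib_left[symmetric])
  also have "(\<Sum>a<r. \<Sum>b<r. X b a) = (\<Sum>a<r. \<Sum>b<r. X a b)" by (rule sum.swap)
  also have "(\<Sum>a<r. \<Sum>b<r. X a b) = (\<Sum>a<r. if a \<in> {a \<in> {..<m}. \<pi> a = \<tau> a} then 1 else 0)"
  proof (intro sum.cong refl)
    fix a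
    have "m + \<pi> a < r" if "a < m" using permutes_in_image[OF \<pi>, of a] that m by simp
    thus "(\<Sum>b<r. X a b) = (if a \<in> {a \<in> {..<m}. \<pi> a = \<tau> a} then 1 else 0)"
      by (auto simp: X_def)
  qed
  also have "\<dots> = card ({..<r} \<inter> {a \<in> {..<m}. \<pi> a = \<tau> a})"
    by (simp only: sum.If_cases[OF finite_lessThan]) (simp add: Int_def)
  also have "{..<r} \<inter> {a \<in> {..<m}. \<pi> a = \<tau> a} = {a \<in> {..<m}. \<pi> a = \<tau> a}" using m by auto
  finally show ?thesis using m by (simp add: power2_eq_square field_simps)
qed

lemma rank_bound:
  fixes \<alpha> \<epsilon> :: real
  assumes \<alpha>: "0 < \<alpha>" "\<alpha> < 1" and \<epsilon>: "0 < \<epsilon>" "\<epsilon> < \<alpha> * (1 - \<alpha>) / 4" and r: "1 / \<epsilon> < real r"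
  shows "\<exists>\<sigma>. density_op r \<sigma> \<and> mrank \<sigma> = r \<and>
      (\<forall>n K M x. povm (r ^ n) K M \<and>
         (\<forall>\<rho>. density_op r \<rho> \<and> mrank \<rho> \<le> r \<longrightarrow>
              success_prob n K M x \<rho> (tsallis_rel_ent \<alpha> \<rho> \<sigma>) \<epsilon> \<ge> 2 / 3)
         \<longrightarrow> real n \<ge> \<alpha> * (1 - \<alpha>) * r / (160 * \<epsilon>))"
proof -
  have rpos: "0 < real r" using \<epsilon> r by (meson less_trans zero_less_divide_1_iff)
  hence r1: "1 \<le> r" by simp
  define \<sigma> where "\<sigma> = mat_diag r (\<lambda>_. complex_of_real (1 / real r))"
  have unif: "0 \<le> 1 / real r" "(\<Sum>i<r. 1 / real r) = 1" using rpos by simp_all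
  have rank: "mrank \<sigma> = r" unfolding \<sigma>_def using rpos by (intro mrank_mat_diag_full) simp
  have dens: "density_op r \<sigma>" unfolding \<sigma>_def by (rule mat_diag_density_op[OF unif])
  have rank_le: "mrank (kernel_mat r t) \<le> r" for t
    using vec_space.rank_le_nc[of "kernel_mat r t" r r] by (simp add: mrank_def kernel_mat_def)
  define m where "m = r div 2"
  have m: "2 * m \<le> r" "r \<le> 2 * m + 1" by (auto simp: m_def)
  \<comment> \<open>This makes the entropy gain
    \<open>\<alpha> * (1 - \<alpha>) * \<delta>^2 / 2\<close> equal to
    \<open>2 * \<epsilon>\<close>; \<open>\<delta> < 1\<close> is exactly the upper bound on
    \<open>\<epsilon>\<close>.\<close>
  define \<delta> where "\<delta> = sqrt (4 * \<epsilon> / (\<alpha> * (1 - \<alpha>)))"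
  have \<alpha>pos: "0 < \<alpha> * (1 - \<alpha>)" using \<alpha> by simp
  have \<delta>2: "\<delta>\<^sup>2 = 4 * \<epsilon> / (\<alpha> * (1 - \<alpha>))" using \<epsilon> \<alpha> by (simp add: \<delta>_def)
  have \<delta>: "0 \<le> \<delta>" "\<delta> < 1" "0 < \<delta>\<^sup>2"
    using \<epsilon> \<alpha>pos \<delta>2 by (simp_all add: \<delta>_def)
  define y where "y = real (2 * m) / real r * (1 - ((1 + \<delta>) powr \<alpha> + (1 - \<delta>) powr \<alpha>) / 2) / (1 - \<alpha>)"
  have gap: "2 * \<epsilon> < y"
  proof -
    have "1 < \<epsilon> * real r" using r \<epsilon> by (simp add: field_simps)
    also have "\<dots> \<le> \<alpha> * real r"
    proof -
      have "\<alpha> * (1 - \<alpha>) / 4 \<le> \<alpha>" using \<alpha> by (simp add: field_simps)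
      thus ?thesis using \<epsilon> rpos by (intro mult_right_mono) auto
    qed
    \<comment> \<open>For odd \<open>r\<close> one coordinate is unmatched. As
      \<open>1 < \<alpha> * r\<close>, the matched fraction still exceeds
      \<open>1 - \<alpha>\<close>, and the division by \<open>1 - \<alpha>\<close> in the divergence
      makes up for the loss.\<close>
    finally have "(1 - \<alpha>) * real r < real (2 * m)" using m by (simp add: algebra_simps)
    hence frac: "1 - \<alpha> < real (2 * m) / real r" using rpos by (simp add: field_simps)
    have "2 * \<epsilon> = (1 - \<alpha>) * (\<alpha> * (1 - \<alpha>) * \<delta>\<^sup>2 / 2) / (1 - \<alpha>)"
      using \<alpha> by (simp add: \<delta>2)
    also have "\<dots> < real (2 * m) / real r * (\<alpha> * (1 - \<alpha>) * \<delta>\<^sup>2 / 2) / (1 - \<alpha>)"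
      using frac \<alpha> \<delta> by (intro divide_strict_right_mono mult_strict_right_mono) auto
    also have "\<dots> \<le> y"
    proof -
      have "\<alpha> * (1 - \<alpha>) * \<delta>\<^sup>2 / 2 \<le> 1 - ((1 + \<delta>) powr \<alpha> + (1 - \<delta>) powr \<alpha>) / 2"
        using binary_powr_mean_le[OF \<alpha> \<delta>(1,2)] by linarith
      thus ?thesis
        unfolding y_def using \<alpha> by (intro divide_right_mono mult_left_mono) simp_all
    qed
    finally show ?thesis .
  qed
  have "real n \<ge> \<alpha> * (1 - \<alpha>) * r / (160 * \<epsilon>)"
    if M: "povm (r ^ n) K M" and succ: "\<And>\<rho>. density_op r \<rho> \<Longrightarrow> mrank \<rho> \<le> r \<Longrightarrow>
              success_prob n K M x \<rho> (tsallis_rel_ent \<alpha> \<rho> \<sigma>) \<epsilon> \<ge> 2 / 3" for n K M x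
  proof -
    define S where "S y = {k. k < K \<and> \<bar>x k - y\<bar> \<le> \<epsilon>}" for y
    have disj: "S 0 \<inter> S y = {}" using gap by (auto simp: S_def)
    let ?P = "{\<pi>. \<pi> permutes {..<m}}"
    let ?t = "matching_kernel r m \<delta>"
    have cardP: "card ?P = fact m" by (simp add: card_permutations)
    have P: "finite ?P" "?P \<noteq> {}"
      using permutes_id[of "{..<m}"] by (simp add: finite_permutations, blast)
    \<comment> \<open>The exponent gained per common edge over \<open>n\<close> copies.\<close>
    define \<kappa> where "\<kappa> = 2 * \<delta>\<^sup>2 / r * n"
    have \<kappa>: "0 \<le> \<kappa>" by (simp add: \<kappa>_def)
    have "2 / 3 \<le> success_prob n K M x \<sigma> 0 \<epsilon>"
      using succ[OF dens] rank tsallis_self[OF \<alpha> unif] by (simp add: \<sigma>_def)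
    hence mixed: "2 / 3 \<le> (\<Sum>i<r ^ n. \<Sum>j<r ^ n. outcome_kernel M (S 0) i j
        * tensor_kernel r (\<lambda>i j. if i = j then 1 / real r else 0) n j i)"
      unfolding \<sigma>_def mat_diag_kernel_mat success_prob_kernel_mat[OF M] S_def .
    have perturbed: "2 / 3 \<le> (\<Sum>i<r ^ n. \<Sum>j<r ^ n. outcome_kernel M (S y) i j
        * tensor_kernel r (?t \<pi>) n j i)" if "\<pi> \<in> ?P" for \<pi>
    proof -
      have \<pi>: "\<pi> permutes {..<m}" using that by simp
      note props = matching_state_props[OF \<pi> m(1) r1 \<delta>(1,2) \<alpha>]
      show ?thesis using succ[OF props(1) rank_le]
        unfolding \<sigma>_def props(2) success_prob_kernel_mat[OF M] S_def y_def .
    qed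
    have "S 0 \<subseteq> {..<K}" "S y \<subseteq> {..<K}" by (auto simp: S_def)
    from mixture_vs_maximally_mixed[OF M this disj _ P matching_kernel_trace[OF r1] mixed perturbed]
    have "10 / 9 * (fact m)\<^sup>2
      \<le> (\<Sum>\<pi>\<in>?P. \<Sum>\<tau>\<in>?P. (r * (\<Sum>i<r. \<Sum>j<r. ?t \<pi> i j * ?t \<tau> i j)) ^ n)"
      using r1 by (simp add: cardP)
    \<comment> \<open>The base is written as \<open>1 + (exp \<kappa> - 1)\<close> to match the
      agreement moment with \<open>x = exp \<kappa> - 1\<close>.\<close>
    also have "\<dots> \<le> (\<Sum>\<pi>\<in>?P. \<Sum>\<tau>\<in>?P. (1 + (exp \<kappa> - 1)) ^ card {a \<in> {..<m}. \<pi> a = \<tau> a})"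
    proof (intro sum_mono)
      fix \<pi> \<tau> assume "\<pi> \<in> ?P" "\<tau> \<in> ?P"
      define F where "F = card {a \<in> {..<m}. \<pi> a = \<tau> a}"
      have "(r * (\<Sum>i<r. \<Sum>j<r. ?t \<pi> i j * ?t \<tau> i j)) ^ n = (1 + 2 * \<delta>\<^sup>2 / r * F) ^ n"
        using \<open>\<pi> \<in> ?P\<close> \<open>\<tau> \<in> ?P\<close> m r1 by (simp add: matching_kernel_inner F_def)
      also have "\<dots> \<le> exp (2 * \<delta>\<^sup>2 / r * F) ^ n"
        by (intro power_mono exp_ge_add_one_self) simp
      also have "\<dots> = exp \<kappa> ^ F"
        by (simp add: \<kappa>_def mult_ac flip: exp_of_nat_mult)
      finally show "(r * (\<Sum>i<r. \<Sum>j<r. ?t \<pi> i j * ?t \<tau> i j)) ^ n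
        \<le> (1 + (exp \<kappa> - 1)) ^ card {a \<in> {..<m}. \<pi> a = \<tau> a}" by (simp add: F_def)
    qed
    also have "\<dots> \<le> (fact m)\<^sup>2 * exp (exp \<kappa> - 1)"
      using permutation_agreement_moment[of "{..<m}" "exp \<kappa> - 1"] \<kappa> by simp
    finally have big: "10 / 9 \<le> exp (exp \<kappa> - 1)" by (simp add: field_simps)
    \<comment> \<open>Otherwise \<open>exp z \<le> 1 + z + z^2\<close>, used twice, gives
      \<open>exp \<kappa> - 1 \<le> 21 / 400\<close> and then a value below 10 / 9.\<close>
    have "1 / 20 < \<kappa>"
    proof (rule ccontr)
      assume "\<not> 1 / 20 < \<kappa>"
      hence le: "\<kappa> \<le> 1 / 20" by simp
      have "\<kappa>\<^sup>2 \<le> (1 / 20)\<^sup>2" using \<kappa> le by (intro power_mono) auto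
      hence 1: "exp \<kappa> - 1 \<le> 21 / 400" using exp_bound[of \<kappa>] \<kappa> le by (simp add: power2_eq_square)
      moreover have "(exp \<kappa> - 1)\<^sup>2 \<le> (21 / 400)\<^sup>2" using \<kappa> 1 by (intro power_mono) auto
      ultimately have "exp (exp \<kappa> - 1) < 10 / 9"
        using exp_bound[of "exp \<kappa> - 1"] \<kappa> by (simp add: power2_eq_square)
      thus False using big by simp
    qed
    \<comment> \<open>Substituting \<open>\<delta>^2\<close> gives
      \<open>\<kappa> = 8 * \<epsilon> * n / A\<close>, and \<open>8 * 20 = 160\<close>.\<close>
    moreover define A where "A = \<alpha> * (1 - \<alpha>) * r"
    moreover have "0 < A" using \<alpha>pos rpos by (simp add: A_def)
    moreover have "\<kappa> = 8 * \<epsilon> * n / A" by (simp add: \<kappa>_def \<delta>2 A_def)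
    ultimately have "A < 160 * \<epsilon> * n" by (simp add: field_simps)
    thus ?thesis using \<epsilon> unfolding A_def[symmetric] by (simp add: field_simps)
  qed
  thus ?thesis using rank dens by blast
qed

section \<open>Combining the two regimes\<close>

theorem mainTheorem12:
  fixes \<alpha> :: real
  assumes "0 < \<alpha>" and "\<alpha> < 1"
  shows "\<exists>c>0. \<forall>(r::nat) (\<epsilon>::real). r \<ge> 1 \<longrightarrow> 0 < \<epsilon> \<longrightarrow> \<epsilon> < \<alpha> * (1 - \<alpha>) / 4 \<longrightarrow>
    (\<exists>d \<sigma>. density_op d \<sigma> \<and> mrank \<sigma> = r \<and>
      (\<forall>(n::nat) (K::nat) M x.
         povm (d ^ n) K M \<and>
         (\<forall>\<rho>. density_op d \<rho> \<and> mrank \<rho> \<le> r \<longrightarrow>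
              success_prob n K M x \<rho> (tsallis_rel_ent \<alpha> \<rho> \<sigma>) \<epsilon> \<ge> 2 / 3)
         \<longrightarrow> real n \<ge> c * (real r / \<epsilon> + 1 / \<epsilon>^2)))"
proof (intro exI[of _ "\<alpha> * (1 - \<alpha>) / 2304"] conjI allI impI)
  show "0 < \<alpha> * (1 - \<alpha>) / 2304" using assms by simp
  fix r :: nat and \<epsilon> :: real
  assume r: "1 \<le> r" and \<epsilon>: "0 < \<epsilon>" "\<epsilon> < \<alpha> * (1 - \<alpha>) / 4"
  \<comment> \<open>Each case bounds the sum by twice its larger term, hence
    \<open>2304 = 2 * 1152\<close>; the factor \<open>\<alpha> * (1 - \<alpha>)\<close> comes from
    the rank bound and is at most 1.\<close>
  let ?c = "\<alpha> * (1 - \<alpha>) / 2304"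
  have c: "0 \<le> ?c" "?c \<le> 1 / 2304"
    using assms mult_mono[of \<alpha> 1 "1 - \<alpha>" 1] by auto
  show "\<exists>d \<sigma>. density_op d \<sigma> \<and> mrank \<sigma> = r \<and>
      (\<forall>(n::nat) (K::nat) M x.
         povm (d ^ n) K M \<and>
         (\<forall>\<rho>. density_op d \<rho> \<and> mrank \<rho> \<le> r \<longrightarrow>
              success_prob n K M x \<rho> (tsallis_rel_ent \<alpha> \<rho> \<sigma>) \<epsilon> \<ge> 2 / 3)
         \<longrightarrow> real n \<ge> ?c * (real r / \<epsilon> + 1 / \<epsilon>^2))"
  \<comment> \<open>The ambient dimension depends on the case: \<open>Suc r\<close> leaves a
    direction outside the support of \<open>\<sigma>\<close>, whereas the maximally mixed state
    fills dimension \<open>r\<close>.\<close>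
  proof (cases "real r \<le> 1 / \<epsilon>")
    case True
    have "real r / \<epsilon> \<le> (1 / \<epsilon>) / \<epsilon>" using True \<epsilon> by (intro divide_right_mono) auto
    hence "real r / \<epsilon> + 1 / \<epsilon>\<^sup>2 \<le> 2 / \<epsilon>\<^sup>2" by (simp add: power2_eq_square)
    hence "?c * (real r / \<epsilon> + 1 / \<epsilon>\<^sup>2) \<le> 1 / 2304 * (2 / \<epsilon>\<^sup>2)"
      using c \<epsilon> by (intro mult_mono) auto
    hence le: "?c * (real r / \<epsilon> + 1 / \<epsilon>\<^sup>2) \<le> 1 / (1152 * \<epsilon>\<^sup>2)" by simp
    from inverse_square_bound[OF assms \<epsilon> r] obtain \<sigma> where \<sigma>: "density_op (Suc r) \<sigma>" "mrank \<sigma> = r"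
      and *: "\<And>n K M x. povm ((Suc r) ^ n) K M \<and>
         (\<forall>\<rho>. density_op (Suc r) \<rho> \<and> mrank \<rho> \<le> r \<longrightarrow>
              success_prob n K M x \<rho> (tsallis_rel_ent \<alpha> \<rho> \<sigma>) \<epsilon> \<ge> 2 / 3)
         \<Longrightarrow> 1 / (1152 * \<epsilon>\<^sup>2) \<le> real n"
      by blast
    show ?thesis
      by (intro exI[of _ "Suc r"] exI[of _ \<sigma>] conjI \<sigma> allI impI) (rule order_trans[OF le *])
  next
    case False
    hence lt: "1 / \<epsilon> < real r" by simp
    have "(1 / \<epsilon>) / \<epsilon> \<le> real r / \<epsilon>" using lt \<epsilon> by (intro divide_right_mono) auto
    hence "real r / \<epsilon> + 1 / \<epsilon>\<^sup>2 \<le> 2 * (real r / \<epsilon>)" by (simp add: power2_eq_square)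
    hence "?c * (real r / \<epsilon> + 1 / \<epsilon>\<^sup>2) \<le> ?c * (2 * (real r / \<epsilon>))"
      using c by (intro mult_left_mono)
    also have "\<dots> = (\<alpha> * (1 - \<alpha>) * r / \<epsilon>) / 1152" using \<epsilon>(1) by (simp add: field_simps)
    also have "\<dots> \<le> (\<alpha> * (1 - \<alpha>) * r / \<epsilon>) / 160"
      using assms \<epsilon> by (intro divide_left_mono) auto
    also have "\<dots> = \<alpha> * (1 - \<alpha>) * r / (160 * \<epsilon>)" by (simp add: mult_ac)
    finally have le: "?c * (real r / \<epsilon> + 1 / \<epsilon>\<^sup>2) \<le> \<alpha> * (1 - \<alpha>) * r / (160 * \<epsilon>)" .
    from rank_bound[OF assms \<epsilon> lt] obtain \<sigma> where \<sigma>: "density_op r \<sigma>" "mrank \<sigma> = r"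
      and *: "\<And>n K M x. povm (r ^ n) K M \<and>
         (\<forall>\<rho>. density_op r \<rho> \<and> mrank \<rho> \<le> r \<longrightarrow>
              success_prob n K M x \<rho> (tsallis_rel_ent \<alpha> \<rho> \<sigma>) \<epsilon> \<ge> 2 / 3)
         \<Longrightarrow> \<alpha> * (1 - \<alpha>) * r / (160 * \<epsilon>) \<le> real n"
      by blast
    show ?thesis
      by (intro exI[of _ "r"] exI[of _ \<sigma>] conjI \<sigma> allI impI) (rule order_trans[OF le *])
  qed
qed

end
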